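(* If $N:\langle\Gamma\vdash U\rangle$ is derivable and $M\rhd^*_\beta N$, then $M:\langle\Gamma\uparrow^M\vdash U\rangle$ is derivable.
   Context: Indexes: finite sequences of natural numbers ($\mathcal L_{\mathbb N}$), $\oslash$ empty, $i::L$ prepending $i$, $L_1\preceq L_2$ (also $L_2\succeq L_1$) iff $L_2=L_1::L_3$ for some $L_3$ (concatenation). Terms: over a countably infinite set $\mathcal V$, terms $\mathcal M$, free indexed variables $\mathrm{fv}$, degree $d$, joinability $\diamond$ defined simultaneously: $x^L\in\mathcal M$ ($\mathrm{fv}=\{x^L\}$, $d=L$); $MN\in\mathcal M$ when $d(M)\preceq d(N)$, $M\diamond N$ ($\mathrm{fv}$ union, $d(MN)=d(M)$); $\lambda x^L.M\in\mathcal M$ when $L\succeq d(M)$ ($\mathrm{fv}(M)\setminus\{x^L\}$, $d=d(M)$). $M\diamond N$ iff $x^L\in\mathrm{fv}(M)$, $x^K\in\mathrm{fv}(N)$ imply $L=K$. Terms modulo $\alpha$; $M[x^L:=N]$ defined only if $M\diamond N$ and $d(N)=L$. $\rhd_\beta$: least relation compatible with abstraction and application containing $(\lambda x^L.M)N\rhd_\beta M[x^L:=N]$ ($d(N)=L$); $\rhd^*_\beta$ its reflexive–transitive closure. Lifting $(x^L)^{+i}=x^{i::L}$, $(M_1M_2)^{+i}=M_1^{+i}M_2^{+i}$, $(\lambda x^L.M)^{+i}=\lambda x^{i::L}.M^{+i}$. Types: atomic types $\mathcal A$, expansion variables $\overline e_0,\overline e_1,\dots$; $\mathbb T\subseteq\mathbb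 U$ with degree: $a\in\mathbb T$ ($d=\oslash$); $U\to T\in\mathbb T$ for $U\in\mathbb U,T\in\mathbb T$ ($d=\oslash$); $\omega^L\in\mathbb U$ ($d=L$); $U_1\sqcap U_2$ if $d(U_1)=d(U_2)$; $\overline e_iU$ ($d=i::d(U)$); modulo $\sqcap$ commutative, associative, idempotent, $\overline e_i(U_1\sqcap U_2)=\overline e_iU_1\sqcap\overline e_iU_2$, $\omega^L\sqcap U=U$ ($d(U)=L$), $\overline e_i\omega^K=\omega^{i::K}$. Environments: finite sets of declarations $x^L:U$ (at most one per $x^L$); $\Gamma,\Delta$ disjoint union; $env^\omega_M$ assigns $\omega^L$ to each $x^L\in\mathrm{fv}(M)$; $\Gamma_1\sqcap\Gamma_2$ intersects types of common variables, keeps others; $\overline e_j\Gamma$ replaces $x^L:U$ by $x^{j::L}:\overline e_jU$; $\Gamma_1\diamond\Gamma_2$ iff $x^L\in\mathrm{dom}\,\Gamma_1$, $x^K\in\mathrm{dom}\,\Gamma_2$ imply $L=K$. If $\mathrm{dom}\,\Gamma\subseteq\mathrm{fv}(M)$, $\Gamma\uparrow^M$ is $\Gamma$ extended with $x^L:\omega^L$ for each $x^L\in\mathrm{fv}(M)\setminus\mathrm{dom}\,\Gamma$. Subtyping $\sqsubseteq$: least relation on types, environments and typings closed under reflexivity, transitivity, $U_1\sqcap U_2\sqsubseteq U_1$ ($d(U_1)=d(U_2)$), $U_1\sqcap U_2\sqsubseteq V_1\sqcap V_2$ if $U_i\sqsubseteq V_i$, $U_1\to T_1\sqsubseteq U_2\to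 T_2$ if $U_2\sqsubseteq U_1$, $T_1\sqsubseteq T_2$, $\overline e_iU_1\sqsubseteq\overline e_iU_2$ if $U_1\sqsubseteq U_2$, $\Gamma,y^L:U_1\sqsubseteq\Gamma,y^L:U_2$ if $U_1\sqsubseteq U_2$, $\langle\Gamma_1\vdash U_1\rangle\sqsubseteq\langle\Gamma_2\vdash U_2\rangle$ if $U_1\sqsubseteq U_2$, $\Gamma_2\sqsubseteq\Gamma_1$. Typing rules ($T\in\mathbb T$): (ax) $x^\oslash:\langle(x^\oslash:T)\vdash T\rangle$; ($\omega$) $M:\langle env^\omega_M\vdash\omega^{d(M)}\rangle$; ($\to_I$) $M:\langle\Gamma,(x^L:U)\vdash T\rangle\Rightarrow\lambda x^L.M:\langle\Gamma\vdash U\to T\rangle$; ($\to'_I$) $M:\langle\Gamma\vdash T\rangle$, $x^L\notin\mathrm{dom}\,\Gamma\Rightarrow\lambda x^L.M:\langle\Gamma\vdash\omega^L\to T\rangle$; ($\to_E$) $M_1:\langle\Gamma_1\vdash U\to T\rangle$, $M_2:\langle\Gamma_2\vdash U\rangle$, $\Gamma_1\diamond\Gamma_2\Rightarrow M_1M_2:\langle\Gamma_1\sqcap\Gamma_2\vdash T\rangle$; ($\sqcap_I$) $M:\langle\Gamma\vdash U_1\rangle$, $M:\langle\Gamma\vdash U_2\rangle\Rightarrow M:\langle\Gamma\vdash U_1\sqcap U_2\rangle$; ($e$) $M:\langle\Gamma\vdash U\rangle\Rightarrow M^{+j}:\langle\overline e_j\Gamma\vdash\overline e_jU\rangle$; ($\sqsubseteq$)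 $M:\langle\Gamma\vdash U\rangle$, $\langle\Gamma\vdash U\rangle\sqsubseteq\langle\Gamma'\vdash U'\rangle\Rightarrow M:\langle\Gamma'\vdash U'\rangle$. *)

theory Defs
  imports Main "HOL-Library.Sublist" "HOL-Library.Countable" "HOL-Library.Infinite_Typeclass"
begin

type_synonym index = "nat list"

type_synonym 'v ivar = "'v \<times> index"

definition joinable :: "'v ivar set \<Rightarrow> 'v ivar set \<Rightarrow> bool" where
  "joinable A B \<longleftrightarrow> (\<forall>x L K. (x, L) \<in> A \<longrightarrow> (x, K) \<in> B \<longrightarrow> L = K)"


section \<open>Terms\<close>

text \<open>
  Terms modulo \<open>\<alpha>\<close> are represented in locally nameless style: only bound variables are
  nameless, and \<open>Abs x L M\<close> below is the named abstraction \<open>\<lambda>x\<^sup>L. M\<close>, so that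
  \<open>\<alpha>\<close>-equivalence is equality. Every occurrence of a variable, free or bound, carries its index.
  The datatype contains junk (dangling or wrongly annotated bound variables, violated degree or
  joinability conditions); the actual terms are the elements of the set \<open>terms\<close>.
\<close>

datatype 'v trm =
    Bnd nat index
  | Var 'v index
  | App "'v trm" "'v trm"
  | Lam index "'v trm"

primrec close :: "nat \<Rightarrow> 'v \<Rightarrow> index \<Rightarrow> 'v trm \<Rightarrow> 'v trm" where
  "close k x L (Bnd n K) = Bnd n K"
| "close k x L (Var y K) = (if y = x \<and> K = L then Bnd k L else Var y K)"
| "close k x L (App M N) = App (close k x L M) (close k x L N)"
| "close k x L (Lam K M) = Lam K (close (Suc k) x L M)"

definition Abs :: "'v \<Rightarrow> index \<Rightarrow> 'v trm \<Rightarrow> 'v trm" where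
  "Abs x L M = Lam L (close 0 x L M)"

primrec fv :: "'v trm \<Rightarrow> 'v ivar set" where
  "fv (Bnd n K) = {}"
| "fv (Var x L) = {(x, L)}"
| "fv (App M N) = fv M \<union> fv N"
| "fv (Lam L M) = fv M"

primrec deg :: "'v trm \<Rightarrow> index" where
  "deg (Bnd n K) = K"
| "deg (Var x L) = L"
| "deg (App M N) = deg M"
| "deg (Lam L M) = deg M"

abbreviation tjoin :: "'v trm \<Rightarrow> 'v trm \<Rightarrow> bool" (infix "\<diamondop>" 50) where
  "M \<diamondop> N \<equiv> joinable (fv M) (fv N)"

inductive_set "terms" :: "'v trm set" where
  var: "Var x L \<in> terms"
| app: "\<lbrakk>M \<in> terms; N \<in> terms; prefix (deg M) (deg N); M \<diamondop> N\<rbrakk> \<Longrightarrow> App M N \<in> terms"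
| abs: "\<lbrakk>M \<in> terms; prefix (deg M) L\<rbrakk> \<Longrightarrow> Abs x L M \<in> terms"

text \<open>\<open>subst x L N M\<close> is \<open>M[x\<^sup>L := N]\<close>; it is only used under the conditions that make
  the latter defined.\<close>

primrec subst :: "'v \<Rightarrow> index \<Rightarrow> 'v trm \<Rightarrow> 'v trm \<Rightarrow> 'v trm" where
  "subst x L N (Bnd n K) = Bnd n K"
| "subst x L N (Var y K) = (if y = x \<and> K = L then N else Var y K)"
| "subst x L N (App M M') = App (subst x L N M) (subst x L N M')"
| "subst x L N (Lam K M) = Lam K (subst x L N M)"

primrec lift :: "nat \<Rightarrow> 'v trm \<Rightarrow> 'v trm" where
  "lift i (Bnd n K) = Bnd n (i # K)"
| "lift i (Var x L) = Var x (i # L)"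
| "lift i (App M N) = App (lift i M) (lift i N)"
| "lift i (Lam L M) = Lam (i # L) (lift i M)"

text \<open>The following equations are the defining clauses for named abstractions.\<close>

lemma fv_close: "fv (close k x L M) = fv M - {(x, L)}"
  by (induction M arbitrary: k) auto

lemma fv_Abs: "fv (Abs x L M) = fv M - {(x, L)}"
  by (simp add: Abs_def fv_close)

lemma deg_close: "deg (close k x L M) = deg M"
  by (induction M arbitrary: k) auto

lemma deg_Abs: "deg (Abs x L M) = deg M"
  by (simp add: Abs_def deg_close)

lemma lift_close: "lift i (close k x L M) = close k x (i # L) (lift i M)"
  by (induction M arbitrary: k) auto

lemma lift_Abs: "lift i (Abs x L M) = Abs x (i # L) (lift i M)"
  by (simp add: Abs_def lift_close)

lemma close_fresh: "(x, L) \<notin> fv M \<Longrightarrow> close k x L M = M"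
  by (induction M arbitrary: k) auto

lemma subst_close:
  "\<lbrakk>(y, K) \<noteq> (x, L); (y, K) \<notin> fv N\<rbrakk> \<Longrightarrow> subst x L N (close k y K M) = close k y K (subst x L N M)"
  by (induction M arbitrary: k) (auto simp: close_fresh)

lemma subst_Abs:
  "\<lbrakk>(y, K) \<noteq> (x, L); (y, K) \<notin> fv N\<rbrakk> \<Longrightarrow> subst x L N (Abs y K M) = Abs y K (subst x L N M)"
  by (simp add: Abs_def subst_close)

lemma close_alpha: "(y, L) \<notin> fv M \<Longrightarrow> close k x L M = close k y L (subst x L (Var y L) M)"
  by (induction M arbitrary: k) auto

lemma Abs_alpha: "(y, L) \<notin> fv M \<Longrightarrow> Abs x L M = Abs y L (subst x L (Var y L) M)"
  by (simp add: Abs_def close_alpha)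

inductive beta :: "'v trm \<Rightarrow> 'v trm \<Rightarrow> bool" (infix "\<rhd>\<^sub>\<beta>" 50) where
  redex: "\<lbrakk>M \<in> terms; N \<in> terms; App (Abs x L M) N \<in> terms; deg N = L; M \<diamondop> N\<rbrakk>
    \<Longrightarrow> App (Abs x L M) N \<rhd>\<^sub>\<beta> subst x L N M"
| abs: "\<lbrakk>M \<rhd>\<^sub>\<beta> N; Abs x L M \<in> terms; Abs x L N \<in> terms\<rbrakk> \<Longrightarrow> Abs x L M \<rhd>\<^sub>\<beta> Abs x L N"
| appL: "\<lbrakk>M \<rhd>\<^sub>\<beta> N; App M P \<in> terms; App N P \<in> terms\<rbrakk> \<Longrightarrow> App M P \<rhd>\<^sub>\<beta> App N P"
| appR: "\<lbrakk>M \<rhd>\<^sub>\<beta> N; App P M \<in> terms; App P N \<in> terms\<rbrakk> \<Longrightarrow> App P M \<rhd>\<^sub>\<beta> App P N"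

abbreviation betas :: "'v trm \<Rightarrow> 'v trm \<Rightarrow> bool" (infix "\<rhd>\<^sub>\<beta>\<^sup>*" 50) where
  "M \<rhd>\<^sub>\<beta>\<^sup>* N \<equiv> beta\<^sup>*\<^sup>* M N"


section \<open>Types\<close>

datatype 'a rty =
    RAtom 'a
  | RArrow "'a rty" "'a rty"
  | ROmega index
  | RInter "'a rty" "'a rty"
  | RExp nat "'a rty"

primrec rdeg :: "'a rty \<Rightarrow> index" where
  "rdeg (RAtom a) = []"
| "rdeg (RArrow U T) = []"
| "rdeg (ROmega L) = L"
| "rdeg (RInter U V) = rdeg U"
| "rdeg (RExp i U) = i # rdeg U"

inductive teq :: "'a rty \<Rightarrow> 'a rty \<Rightarrow> bool" where
  refl: "teq U U"
| sym: "teq U V \<Longrightarrow> teq V U"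
| trans: "\<lbrakk>teq U V; teq V W\<rbrakk> \<Longrightarrow> teq U W"
| arrow: "\<lbrakk>teq U U'; teq T T'\<rbrakk> \<Longrightarrow> teq (RArrow U T) (RArrow U' T')"
| inter: "\<lbrakk>teq U U'; teq V V'\<rbrakk> \<Longrightarrow> teq (RInter U V) (RInter U' V')"
| exp: "teq U U' \<Longrightarrow> teq (RExp i U) (RExp i U')"
| comm: "rdeg U = rdeg V \<Longrightarrow> teq (RInter U V) (RInter V U)"
| assoc: "\<lbrakk>rdeg U = rdeg V; rdeg V = rdeg W\<rbrakk>
    \<Longrightarrow> teq (RInter (RInter U V) W) (RInter U (RInter V W))"
| idem: "teq (RInter U U) U"
| exp_inter: "rdeg U = rdeg V \<Longrightarrow> teq (RExp i (RInter U V)) (RInter (RExp i U) (RExp i V))"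
| omega_inter: "rdeg U = L \<Longrightarrow> teq (RInter (ROmega L) U) U"
| exp_omega: "teq (RExp i (ROmega K)) (ROmega (i # K))"

lemma teq_rdeg: "teq U V \<Longrightarrow> rdeg U = rdeg V"
  by (induction rule: teq.induct) auto

text \<open>The quotient still contains ill-formed classes, such as intersections of types of different
  degrees; the actual types are the elements of \<open>UU\<close> and \<open>TT\<close> below.\<close>

quotient_type 'a ty = "'a rty" / teq
  by (rule equivpI) (auto intro: reflpI sympI transpI teq.refl teq.sym teq.trans)

lift_definition Atom :: "'a \<Rightarrow> 'a ty" is RAtom .

lift_definition Arrow :: "'a ty \<Rightarrow> 'a ty \<Rightarrow> 'a ty" is RArrow by (rule teq.arrow)

lift_definition Omega :: "index \<Rightarrow> 'a ty" is ROmega .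

lift_definition Inter :: "'a ty \<Rightarrow> 'a ty \<Rightarrow> 'a ty" is RInter by (rule teq.inter)

lift_definition Exp :: "nat \<Rightarrow> 'a ty \<Rightarrow> 'a ty" is RExp by (rule teq.exp)

lift_definition tdeg :: "'a ty \<Rightarrow> index" is rdeg by (rule teq_rdeg)

inductive_set TT :: "'a ty set" and UU :: "'a ty set" where
  atom: "Atom a \<in> TT"
| arrow: "\<lbrakk>U \<in> UU; T \<in> TT\<rbrakk> \<Longrightarrow> Arrow U T \<in> TT"
| TT_UU: "T \<in> TT \<Longrightarrow> T \<in> UU"
| omega: "Omega L \<in> UU"
| inter: "\<lbrakk>U \<in> UU; V \<in> UU; tdeg U = tdeg V\<rbrakk> \<Longrightarrow> Inter U V \<in> UU"
| exp: "U \<in> UU \<Longrightarrow> Exp i U \<in> UU"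


section \<open>Environments\<close>

type_synonym ('v, 'a) env = "'v ivar \<rightharpoonup> 'a ty"

definition wf_env :: "('v, 'a) env \<Rightarrow> bool" where
  "wf_env \<Gamma> \<longleftrightarrow> finite (dom \<Gamma>) \<and> ran \<Gamma> \<subseteq> UU"

definition env_omega :: "'v trm \<Rightarrow> ('v, 'a) env" where
  "env_omega M = (\<lambda>(x, L). if (x, L) \<in> fv M then Some (Omega L) else None)"

definition env_inter :: "('v, 'a) env \<Rightarrow> ('v, 'a) env \<Rightarrow> ('v, 'a) env" where
  "env_inter \<Gamma>\<^sub>1 \<Gamma>\<^sub>2 = (\<lambda>v. case (\<Gamma>\<^sub>1 v, \<Gamma>\<^sub>2 v) of
      (Some U, Some V) \<Rightarrow> Some (Inter U V)
    | (Some U, None) \<Rightarrow> Some U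
    | (None, r) \<Rightarrow> r)"

definition env_exp :: "nat \<Rightarrow> ('v, 'a) env \<Rightarrow> ('v, 'a) env" where
  "env_exp j \<Gamma> = (\<lambda>(x, K). case K of
      [] \<Rightarrow> None
    | i # L \<Rightarrow> if i = j then map_option (Exp j) (\<Gamma> (x, L)) else None)"

abbreviation env_join :: "('v, 'a) env \<Rightarrow> ('v, 'a) env \<Rightarrow> bool" where
  "env_join \<Gamma>\<^sub>1 \<Gamma>\<^sub>2 \<equiv> joinable (dom \<Gamma>\<^sub>1) (dom \<Gamma>\<^sub>2)"

text \<open>\<open>env_up \<Gamma> M\<close> is \<open>\<Gamma>\<up>\<^sup>M\<close>, for \<open>dom \<Gamma> \<subseteq> fv M\<close>; \<open>++\<close> gives priority to \<open>\<Gamma>\<close>.\<close>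

definition env_up :: "('v, 'a) env \<Rightarrow> 'v trm \<Rightarrow> ('v, 'a) env" where
  "env_up \<Gamma> M = env_omega M ++ \<Gamma>"


section \<open>Subtyping\<close>

inductive sub :: "'a ty \<Rightarrow> 'a ty \<Rightarrow> bool" (infix "\<sqsubseteq>" 50) where
  refl: "U \<in> UU \<Longrightarrow> U \<sqsubseteq> U"
| trans: "\<lbrakk>U \<sqsubseteq> V; V \<sqsubseteq> W\<rbrakk> \<Longrightarrow> U \<sqsubseteq> W"
| inter_elim: "\<lbrakk>U\<^sub>1 \<in> UU; U\<^sub>2 \<in> UU; tdeg U\<^sub>1 = tdeg U\<^sub>2\<rbrakk> \<Longrightarrow> Inter U\<^sub>1 U\<^sub>2 \<sqsubseteq> U\<^sub>1"
| inter: "\<lbrakk>U\<^sub>1 \<sqsubseteq> V\<^sub>1; U\<^sub>2 \<sqsubseteq> V\<^sub>2; tdeg U\<^sub>1 = tdeg U\<^sub>2; tdeg V\<^sub>1 = tdeg V\<^sub>2\<rbrakk>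
    \<Longrightarrow> Inter U\<^sub>1 U\<^sub>2 \<sqsubseteq> Inter V\<^sub>1 V\<^sub>2"
| arrow: "\<lbrakk>U\<^sub>2 \<sqsubseteq> U\<^sub>1; T\<^sub>1 \<sqsubseteq> T\<^sub>2; T\<^sub>1 \<in> TT; T\<^sub>2 \<in> TT\<rbrakk> \<Longrightarrow> Arrow U\<^sub>1 T\<^sub>1 \<sqsubseteq> Arrow U\<^sub>2 T\<^sub>2"
| exp: "U\<^sub>1 \<sqsubseteq> U\<^sub>2 \<Longrightarrow> Exp i U\<^sub>1 \<sqsubseteq> Exp i U\<^sub>2"

inductive sub_env :: "('v, 'a) env \<Rightarrow> ('v, 'a) env \<Rightarrow> bool" where
  refl: "wf_env \<Gamma> \<Longrightarrow> sub_env \<Gamma> \<Gamma>"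
| trans: "\<lbrakk>sub_env \<Gamma>\<^sub>1 \<Gamma>\<^sub>2; sub_env \<Gamma>\<^sub>2 \<Gamma>\<^sub>3\<rbrakk> \<Longrightarrow> sub_env \<Gamma>\<^sub>1 \<Gamma>\<^sub>3"
| decl: "\<lbrakk>wf_env \<Gamma>; (y, L) \<notin> dom \<Gamma>; U\<^sub>1 \<sqsubseteq> U\<^sub>2\<rbrakk>
    \<Longrightarrow> sub_env (\<Gamma>((y, L) \<mapsto> U\<^sub>1)) (\<Gamma>((y, L) \<mapsto> U\<^sub>2))"

inductive sub_typing :: "('v, 'a) env \<times> 'a ty \<Rightarrow> ('v, 'a) env \<times> 'a ty \<Rightarrow> bool" where
  refl: "\<lbrakk>wf_env \<Gamma>; U \<in> UU\<rbrakk> \<Longrightarrow> sub_typing (\<Gamma>, U) (\<Gamma>, U)"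
| trans: "\<lbrakk>sub_typing \<Phi>\<^sub>1 \<Phi>\<^sub>2; sub_typing \<Phi>\<^sub>2 \<Phi>\<^sub>3\<rbrakk> \<Longrightarrow> sub_typing \<Phi>\<^sub>1 \<Phi>\<^sub>3"
| pair: "\<lbrakk>U\<^sub>1 \<sqsubseteq> U\<^sub>2; sub_env \<Gamma>\<^sub>2 \<Gamma>\<^sub>1\<rbrakk> \<Longrightarrow> sub_typing (\<Gamma>\<^sub>1, U\<^sub>1) (\<Gamma>\<^sub>2, U\<^sub>2)"


section \<open>Typing\<close>

inductive typing :: "'v trm \<Rightarrow> ('v, 'a) env \<Rightarrow> 'a ty \<Rightarrow> bool"
    ("(_ \<Colon> \<langle>_ \<turnstile> _\<rangle>)" [51, 51, 51] 50) where
  ax: "T \<in> TT \<Longrightarrow> Var x [] \<Colon> \<langle>[(x, []) \<mapsto> T] \<turnstile> T\<rangle>"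
| omega: "M \<in> terms \<Longrightarrow> M \<Colon> \<langle>env_omega M \<turnstile> Omega (deg M)\<rangle>"
| arrI: "\<lbrakk>M \<Colon> \<langle>\<Gamma>((x, L) \<mapsto> U) \<turnstile> T\<rangle>; (x, L) \<notin> dom \<Gamma>; T \<in> TT\<rbrakk>
    \<Longrightarrow> Abs x L M \<Colon> \<langle>\<Gamma> \<turnstile> Arrow U T\<rangle>"
| arrI': "\<lbrakk>M \<Colon> \<langle>\<Gamma> \<turnstile> T\<rangle>; (x, L) \<notin> dom \<Gamma>; T \<in> TT\<rbrakk>
    \<Longrightarrow> Abs x L M \<Colon> \<langle>\<Gamma> \<turnstile> Arrow (Omega L) T\<rangle>"
| arrE: "\<lbrakk>M\<^sub>1 \<Colon> \<langle>\<Gamma>\<^sub>1 \<turnstile> Arrow U T\<rangle>; M\<^sub>2 \<Colon> \<langle>\<Gamma>\<^sub>2 \<turnstile> U\<rangle>; env_join \<Gamma>\<^sub>1 \<Gamma>\<^sub>2; U \<in> UU; T \<in> TT\<rbrakk>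
    \<Longrightarrow> App M\<^sub>1 M\<^sub>2 \<Colon> \<langle>env_inter \<Gamma>\<^sub>1 \<Gamma>\<^sub>2 \<turnstile> T\<rangle>"
| interI: "\<lbrakk>M \<Colon> \<langle>\<Gamma> \<turnstile> U\<^sub>1\<rangle>; M \<Colon> \<langle>\<Gamma> \<turnstile> U\<^sub>2\<rangle>\<rbrakk> \<Longrightarrow> M \<Colon> \<langle>\<Gamma> \<turnstile> Inter U\<^sub>1 U\<^sub>2\<rangle>"
| exp: "M \<Colon> \<langle>\<Gamma> \<turnstile> U\<rangle> \<Longrightarrow> lift j M \<Colon> \<langle>env_exp j \<Gamma> \<turnstile> Exp j U\<rangle>"
| sub: "\<lbrakk>M \<Colon> \<langle>\<Gamma> \<turnstile> U\<rangle>; sub_typing (\<Gamma>, U) (\<Gamma>', U')\<rbrakk> \<Longrightarrow> M \<Colon> \<langle>\<Gamma>' \<turnstile> U'\<rangle>"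

end

theory Submission
  imports Defs "HOL-Combinatorics.Transposition"
begin

text \<open>
  A single reduction step is undone by induction on the typing derivation of the reduct, not on the
  reduction; subtyping and intersection introduction are then trivial cases, and no
  generation lemmas are needed. For the expansion rule, a term of degree \<open>j::L\<close> and its reductions
  are lifted by \<open>j\<close> from a term of degree \<open>L\<close>. The redex itself only has to be treated at types
  in \<open>TT\<close>, where the arrow rules apply: if \<open>M[x\<^sup>L := N]\<close> has type \<open>T\<close>, a second induction on typings
  collects the types at which the copies of \<open>N\<close> are used into one intersection \<open>V\<close>, so that \<open>N\<close>
  has type \<open>V\<close> and \<open>M\<close> has type \<open>T\<close> when \<open>x\<^sup>L\<close> is assigned \<open>V\<close>. If \<open>x\<^sup>L\<close> is not free in \<open>M\<close>, the
  lost variables of \<open>N\<close> receive the types \<open>\<omega>\<close>. Both inductions need the binders of the derivation to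
  be fresh, which is achieved by closing the induction predicate under bijective renamings.
\<close>

section \<open>Terms\<close>

lemma joinable_mono: "joinable A B \<Longrightarrow> A' \<subseteq> A \<Longrightarrow> B' \<subseteq> B \<Longrightarrow> joinable A' B'"
  unfolding joinable_def by blast

lemma finite_fv: "finite (fv M)"
  by (induction M) auto

text \<open>Application is the only constructor that brings new pairs of free variables together,
  and its formation rule demands joinability of the two parts. Hence a name is free in a term with
  at most one index.\<close>

lemma terms_self_joinable: "M \<in> terms \<Longrightarrow> M \<diamondop> M"
proof (induction rule: terms.induct)
  case (app M N)
  then show ?case unfolding joinable_def by (simp, blast)
qed (auto simp: joinable_def fv_Abs)

lemma terms_prefix_deg: "M \<in> terms \<Longrightarrow> (x, L) \<in> fv M \<Longrightarrow> prefix (deg M) L"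
  by (induction rule: terms.induct) (auto simp: fv_Abs deg_Abs intro: prefix_order.trans)

text \<open>Excludes dangling bound variables below \<open>k\<close> enclosing binders. This is the
  part of being a term that makes \<open>close\<close> injective: a dangling \<open>Bnd k L\<close>
  could not be told apart from the image of a closed \<open>Var x L\<close>.\<close>

primrec locally_closed :: "nat \<Rightarrow> 'v trm \<Rightarrow> bool" where
  "locally_closed k (Bnd n K) \<longleftrightarrow> n < k"
| "locally_closed k (Var x L) \<longleftrightarrow> True"
| "locally_closed k (App M N) \<longleftrightarrow> locally_closed k M \<and> locally_closed k N"
| "locally_closed k (Lam L M) \<longleftrightarrow> locally_closed (Suc k) M"

lemma locally_closed_close: "locally_closed k M \<Longrightarrow> locally_closed (Suc k) (close k x L M)"
  by (induction M arbitrary: k) auto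

lemma terms_locally_closed: "M \<in> terms \<Longrightarrow> locally_closed 0 M"
  by (induction rule: terms.induct) (auto simp: Abs_def locally_closed_close)

text \<open>All dangling indexes of the arguments are below \<open>k\<close>, so in the closed term
  an index pointing to level \<open>k\<close> can only stem from an occurrence of
  \<open>x^L\<close>.\<close>

lemma close_inject:
  "\<lbrakk>locally_closed k M; locally_closed k N; close k x L M = close k x L N\<rbrakk> \<Longrightarrow> M = N"
proof (induction M arbitrary: k N)
  case (Bnd n K)
  then show ?case by (cases N) (auto split: if_splits)
next
  case (Var y K)
  then show ?case by (cases N) (auto split: if_splits)
next
  case (App M1 M2)
  then show ?case by (cases N) (auto split: if_splits)
next
  case (Lam K M)
  then show ?case by (cases N) (auto split: if_splits)
qed

lemma Abs_inject:
  "\<lbrakk>locally_closed 0 M; locally_closed 0 N; Abs x L M = Abs x L N\<rbrakk> \<Longrightarrow> M = N"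
  by (rule close_inject[of 0 M N x L]) (simp_all add: Abs_def)

lemma locally_closed_mono: "locally_closed k M \<Longrightarrow> k \<le> k' \<Longrightarrow> locally_closed k' M"
  by (induction M arbitrary: k k') auto

lemma locally_closed_subst:
  "\<lbrakk>locally_closed k M; locally_closed 0 N\<rbrakk> \<Longrightarrow> locally_closed k (subst x L N M)"
  by (induction M arbitrary: k) (auto intro: locally_closed_mono)

section \<open>Inversion of term formation; free variables and degree of a substitution
  instance\<close>

lemma terms_AppD:
  assumes "App M N \<in> terms"
  shows "M \<in> terms" "N \<in> terms" "prefix (deg M) (deg N)" "M \<diamondop> N"
  using assms by (cases rule: terms.cases; simp add: Abs_def)+

text \<open>The formation rule may have used another name and another body, but the annotation of
  the binder and the degree of the body are the same for both presentations.\<close>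

lemma terms_AbsD: "Abs x L M \<in> terms \<Longrightarrow> prefix (deg M) L"
  by (erule terms.cases) (auto simp: Abs_def deg_close dest!: arg_cong[where f = deg])

lemma fv_subst_subset: "fv (subst x L N M) \<subseteq> (fv M - {(x, L)}) \<union> fv N"
  by (induction M) auto

text \<open>One occurrence of \<open>x^L\<close> is enough for all free variables of
  \<open>N\<close> to appear. Without one they would be lost, which is why the two situations are
  separated in the treatment of a redex.\<close>

lemma fv_subst: "(x, L) \<in> fv M \<Longrightarrow> fv (subst x L N M) = (fv M - {(x, L)}) \<union> fv N"
proof (induction M)
  case (App M1 M2)
  have *: "fv (subst x L N M) = fv M" if "(x, L) \<notin> fv M" for M
    using that by (induction M) auto
  show ?case
    using App * [of M1] * [of M2] by (cases "(x, L) \<in> fv M1"; cases "(x, L) \<in> fv M2") auto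
qed auto

lemma subst_fresh: "(x, L) \<notin> fv M \<Longrightarrow> subst x L N M = M"
  by (induction M) auto

lemma deg_subst: "deg N = L \<Longrightarrow> deg (subst x L N M) = deg M"
  by (induction M) auto


subsection \<open>Renaming\<close>

lemma fv_map_trm: "fv (map_trm f M) = map_prod f id ` fv M"
  by (induction M) auto

lemma locally_closed_map_trm [simp]: "locally_closed k (map_trm f M) \<longleftrightarrow> locally_closed k M"
  by (induction M arbitrary: k) auto

lemma deg_map_trm [simp]: "deg (map_trm f M) = deg M"
  by (induction M) auto

lemma close_map_trm: "inj f \<Longrightarrow> close k (f x) L (map_trm f M) = map_trm f (close k x L M)"
  by (induction M arbitrary: k) (auto simp: inj_eq)

lemma Abs_map_trm: "inj f \<Longrightarrow> map_trm f (Abs x L M) = Abs (f x) L (map_trm f M)"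
  by (simp add: Abs_def close_map_trm)

lemma subst_map_trm:
  "inj f \<Longrightarrow> map_trm f (subst x L N M) = subst (f x) L (map_trm f N) (map_trm f M)"
  by (induction M) (auto simp: inj_eq)

lemma lift_map_trm: "lift j (map_trm f M) = map_trm f (lift j M)"
  by (induction M) auto

lemma joinable_map: "inj f \<Longrightarrow> joinable A B \<Longrightarrow> joinable (map_prod f id ` A) (map_prod f id ` B)"
  unfolding joinable_def by (fastforce simp: inj_eq)

lemma terms_map_trm: "M \<in> terms \<Longrightarrow> inj f \<Longrightarrow> map_trm f M \<in> terms"
  by (induction rule: terms.induct)
    (auto simp: Abs_map_trm fv_map_trm joinable_map intro!: terms.intros)

lemma beta_map_trm: "M \<rhd>\<^sub>\<beta> N \<Longrightarrow> inj f \<Longrightarrow> map_trm f M \<rhd>\<^sub>\<beta> map_trm f N"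
proof (induction rule: beta.induct)
  case (redex M N x L)
  have "App (Abs (f x) L (map_trm f M)) (map_trm f N) \<in> terms"
    using terms_map_trm[OF redex(3,6)] redex(6) by (simp add: Abs_map_trm)
  then show ?case
    using redex by (auto simp: Abs_map_trm subst_map_trm fv_map_trm joinable_map terms_map_trm
        intro!: beta.redex)
next
  case (abs M N x L)
  then show ?case
    using terms_map_trm[of "Abs x L M" f] terms_map_trm[of "Abs x L N" f]
    by (auto simp: Abs_map_trm intro!: beta.abs)
next
  case (appL M N P)
  then show ?case
    using terms_map_trm[of "App M P" f] terms_map_trm[of "App N P" f]
    by (auto intro!: beta.appL)
next
  case (appR M N P)
  then show ?case
    using terms_map_trm[of "App P M" f] terms_map_trm[of "App P N" f]
    by (auto intro!: beta.appR)
qed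

text \<open>Renaming acts on a name at all its indexes simultaneously, as joinability demands. It agrees
  with the renaming of a single indexed variable, because a variable that is free in a term is
  free there with only one index.\<close>

lemma Abs_transpose:
  assumes "\<And>K. (x, K) \<in> fv M \<Longrightarrow> K = L" and "\<And>K. (y, K) \<notin> fv M"
  shows "Abs x L M = Abs y L (map_trm (transpose x y) M)"
proof -
  have "close k x L M = close k y L (map_trm (transpose x y) M)" for k
    using assms by (induction M arbitrary: k) (auto simp: transpose_def)
  then show ?thesis by (simp add: Abs_def)
qed

section \<open>Renaming binders to chosen fresh names\<close>

lemma ex_fresh_name:
  fixes S :: "'v::infinite ivar set"
  assumes "finite S" "finite C"
  obtains y where "y \<notin> C" "\<And>K. (y, K) \<notin> S"
proof -
  have "finite (C \<union> fst ` S)" using assms by simp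
  then obtain y where "y \<notin> C \<union> fst ` S" using ex_new_if_finite infinite_UNIV by blast
  then show thesis using that by force
qed

text \<open>A single renaming serves all bodies with free variables among those of \<open>M\<close>,
  so that a body and its reduct can be renamed together. If \<open>x^L\<close> is not free in
  \<open>M\<close>, or if \<open>y\<close> is \<open>x\<close>, the identity suffices.\<close>

lemma Abs_rename:
  assumes "M \<in> terms" "\<And>K. (y, K) \<notin> fv (Abs x L M)"
  shows "\<exists>f. inj f \<and> Abs x L M = Abs y L (map_trm f M) \<and>
    (\<forall>N. fv N \<subseteq> fv M \<longrightarrow> Abs x L N = Abs y L (map_trm f N))"
proof (cases "(x, L) \<in> fv M \<and> y \<noteq> x")
  case True
  have "K = L" if "(x, K) \<in> fv M" for K
    using terms_self_joinable[OF assms(1)] True that unfolding joinable_def by blast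
  moreover have "(y, K) \<notin> fv M" for K
    using assms(2)[of K] True by (simp add: fv_Abs)
  ultimately have "Abs x L N = Abs y L (map_trm (transpose x y) N)" if "fv N \<subseteq> fv M" for N
    using that Abs_transpose[of x N L y] by blast
  then show ?thesis by (intro exI[of _ "transpose x y"]) auto
next
  case False
  then have "Abs x L N = Abs y L N" if "fv N \<subseteq> fv M" for N
    using that assms(2)[of L] close_fresh[of x L N 0] close_fresh[of y L N 0]
    by (fastforce simp: fv_close Abs_def)
  then show ?thesis by (intro exI[of _ id]) (auto simp: trm.map_id0)
qed

text \<open>Plain inversion opens the binder with an unknown name; renaming afterwards allows any
  fresh \<open>y\<close> to be prescribed.\<close>

lemma terms_LamE:
  assumes "Lam L M \<in> terms" "\<And>K. (y, K) \<notin> fv M"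
  obtains M' where "Lam L M = Abs y L M'" "M' \<in> terms" "prefix (deg M') L"
  using assms(1)
proof (cases rule: terms.cases)
  case (abs M0 L' x)
  then have eq: "Lam L M = Abs x L M0" by (simp add: Abs_def)
  then have "(y, K) \<notin> fv (Abs x L M0)" for K using assms(2) by (metis fv.simps(4))
  from Abs_rename[OF abs(2) this] obtain f where "inj f" "Abs x L M0 = Abs y L (map_trm f M0)"
    by blast
  then show thesis
    using that[of "map_trm f M0"] abs eq terms_map_trm[of M0 f] by (simp add: Abs_def)
qed

section \<open>Invariants and inversion of reduction steps\<close>

lemma beta_terms: "M \<rhd>\<^sub>\<beta> N \<Longrightarrow> M \<in> terms"
  by (erule beta.cases) auto

text \<open>Substituting a term without dangling indexes creates none. This is the condition under
  which \<open>Abs\<close> can be cancelled on the reduct of a step.\<close>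

lemma beta_locally_closed: "M \<rhd>\<^sub>\<beta> N \<Longrightarrow> locally_closed 0 N"
  by (erule beta.cases)
    (auto simp: terms_locally_closed locally_closed_subst dest: terms_AppD(1,2))

lemma beta_fv: "M \<rhd>\<^sub>\<beta> N \<Longrightarrow> fv N \<subseteq> fv M"
proof (induction rule: beta.induct)
  case (redex M N x L)
  then show ?case using fv_subst_subset[of x L N M] by (simp add: fv_Abs)
qed (auto simp: fv_Abs)

lemma beta_deg: "M \<rhd>\<^sub>\<beta> N \<Longrightarrow> deg N = deg M"
  by (induction rule: beta.induct) (auto simp: deg_Abs deg_subst)

text \<open>Inversion of a step onto an abstraction whose bound name \<open>y\<close> is prescribed.
  The rule for abstractions supplies some other name; a step creates no free variables, so one
  renaming moves both bodies to \<open>y\<close>, and cancelling \<open>Abs\<close> identifies the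
  renamed reduct with \<open>P\<close>.\<close>

lemma beta_Abs_cases:
  assumes "M \<rhd>\<^sub>\<beta> Abs y K P" "P \<in> terms" "\<And>J. (y, J) \<notin> fv M"
  obtains (redex) x L M' N where "M = App (Abs x L M') N" "Abs y K P = subst x L N M'"
      "M' \<in> terms" "N \<in> terms" "M \<in> terms" "deg N = L" "M' \<diamondop> N"
  | (abs) M' where "M = Abs y K M'" "M' \<rhd>\<^sub>\<beta> P"
  using assms(1)
proof (cases rule: beta.cases)
  case (redex M' N x L)
  then show thesis by (intro that(1)) auto
next
  case (abs M0 P0 z L)
  then have [simp]: "L = K" by (simp add: Abs_def)
  have "(y, J) \<notin> fv (Abs z K M0)" for J using assms(3) abs by simp
  from Abs_rename[OF beta_terms[OF abs(3)] this] obtain f where f: "inj f"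
    "Abs z K M0 = Abs y K (map_trm f M0)" "Abs z K P0 = Abs y K (map_trm f P0)"
    using beta_fv[OF abs(3)] by blast
  have "map_trm f P0 = P"
    using f(3) abs beta_locally_closed[OF abs(3)] terms_locally_closed[OF assms(2)]
    by (intro Abs_inject[of _ P y K]) auto
  then show thesis
    using that(2)[of "map_trm f M0"] f abs beta_map_trm[OF abs(3) f(1)] by simp
qed (simp_all add: Abs_def)


subsection \<open>Lifting\<close>

lemma fv_lift: "fv (lift j M) = map_prod id ((#) j) ` fv M"
  by (induction M) auto

lemma deg_lift [simp]: "deg (lift j M) = j # deg M"
  by (induction M) auto

lemma lift_inject: "lift j M = lift j N \<Longrightarrow> M = N"
proof (induction M arbitrary: N)
  case (Bnd n K)
  then show ?case by (cases N) auto
next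
  case (Var y K)
  then show ?case by (cases N) auto
next
  case (App M1 M2)
  then show ?case by (cases N) auto
next
  case (Lam K M)
  then show ?case by (cases N) auto
qed

lemma subst_lift: "subst x (j # L) (lift j N) (lift j M) = lift j (subst x L N M)"
  by (induction M) auto

lemma joinable_lift:
  "joinable (map_prod id ((#) j) ` A) (map_prod id ((#) j) ` B) \<longleftrightarrow> joinable A B"
  unfolding joinable_def by force

section \<open>Terms and reduction steps under lifting, in both directions\<close>

lemma terms_lift: "M \<in> terms \<Longrightarrow> lift j M \<in> terms"
  by (induction rule: terms.induct)
    (auto simp: lift_Abs fv_lift joinable_lift intro!: terms.intros)

text \<open>The degree of a function part is a prefix of the degree of its argument, and the degree
  of a body is a prefix of the index of its binder. So a leading \<open>j\<close> of the degree
  heads every index in the term and can be stripped everywhere.\<close>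

lemma terms_deg_Cons:
  "M \<in> terms \<Longrightarrow> deg M = j # K \<Longrightarrow> \<exists>M'\<in>terms. M = lift j M'"
proof (induction arbitrary: K rule: terms.induct)
  case (var x L)
  then show ?case by (auto intro!: bexI[of _ "Var x K"] terms.var)
next
  case (app M N)
  obtain M' where M': "M' \<in> terms" "M = lift j M'" using app.IH(1) app.prems by auto
  moreover obtain K' where "deg N = j # K'"
    using app.hyps(3) app.prems by (auto simp: prefix_def)
  then obtain N' where N': "N' \<in> terms" "N = lift j N'" using app.IH(2) by auto
  ultimately have "App M' N' \<in> terms"
    using app.hyps by (auto simp: fv_lift joinable_lift intro!: terms.app)
  then show ?case using M' N' by (intro bexI[of _ "App M' N'"]) auto
next
  case (abs M L x)
  obtain M' where M': "M' \<in> terms" "M = lift j M'" using abs.IH abs.prems by (auto simp: deg_Abs)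
  moreover obtain L' where L': "L = j # L'"
    using abs.hyps(2) abs.prems by (auto simp: prefix_def deg_Abs)
  ultimately have "Abs x L' M' \<in> terms"
    using abs.hyps by (auto intro!: terms.abs)
  then show ?case using M' L' by (intro bexI[of _ "Abs x L' M'"]) (auto simp: lift_Abs)
qed

lemma terms_liftD: "lift j M \<in> terms \<Longrightarrow> M \<in> terms"
  using terms_deg_Cons[of "lift j M" j "deg M"] lift_inject by fastforce

text \<open>All parts of the redex are liftings by \<open>j\<close>, and substitution commutes with
  lifting. The side conditions of the unlifted step follow because being a term is reflected by
  \<open>lift\<close>.\<close>

lemma beta_deg_Cons:
  "M \<rhd>\<^sub>\<beta> P \<Longrightarrow> deg M = j # K \<Longrightarrow> \<exists>M' P'. M = lift j M' \<and> P = lift j P' \<and> M' \<rhd>\<^sub>\<beta> P'"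
proof (induction arbitrary: K rule: beta.induct)
  case (redex M N x L)
  obtain M' where M': "M' \<in> terms" "M = lift j M'"
    using terms_deg_Cons redex.hyps(1) redex.prems by (fastforce simp: deg_Abs)
  obtain L' where L': "L = j # L'"
    using terms_AbsD[OF terms_AppD(1)[OF redex.hyps(3)]] redex.prems
    by (auto simp: prefix_def deg_Abs)
  then obtain N' where N': "N' \<in> terms" "N = lift j N'"
    using terms_deg_Cons redex.hyps(2,4) by blast
  have "lift j (App (Abs x L' M') N') \<in> terms"
    using redex.hyps(3) M' L' N' by (simp add: lift_Abs)
  then have "App (Abs x L' M') N' \<in> terms" by (rule terms_liftD)
  then have "App (Abs x L' M') N' \<rhd>\<^sub>\<beta> subst x L' N' M'"
    using redex.hyps(4,5) M' L' N'
    by (intro beta.redex) (auto simp: fv_lift joinable_lift)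
  moreover have "App (Abs x L M) N = lift j (App (Abs x L' M') N')"
    using M' L' N' by (simp add: lift_Abs)
  moreover have "subst x L N M = lift j (subst x L' N' M')"
    using M' L' N' by (simp add: subst_lift)
  ultimately show ?case by blast
next
  case (abs M P x L)
  obtain M' P' where IH: "M = lift j M'" "P = lift j P'" "M' \<rhd>\<^sub>\<beta> P'"
    using abs.IH abs.prems by (auto simp: deg_Abs)
  obtain L' where L': "L = j # L'"
    using terms_AbsD[OF abs.hyps(2)] abs.prems by (auto simp: prefix_def deg_Abs)
  have "lift j (Abs x L' M') \<in> terms" "lift j (Abs x L' P') \<in> terms"
    using abs.hyps IH L' by (simp_all add: lift_Abs)
  then have "Abs x L' M' \<rhd>\<^sub>\<beta> Abs x L' P'"
    using IH by (blast intro: beta.abs terms_liftD)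
  then show ?case using IH L' by (metis lift_Abs)
next
  case (appL M P Q)
  obtain M' P' where IH: "M = lift j M'" "P = lift j P'" "M' \<rhd>\<^sub>\<beta> P'"
    using appL.IH appL.prems by auto
  obtain K' where "deg Q = j # K'"
    using terms_AppD(3)[OF appL.hyps(2)] appL.prems by (auto simp: prefix_def)
  then obtain Q' where Q': "Q = lift j Q'"
    using terms_deg_Cons terms_AppD(2)[OF appL.hyps(2)] by blast
  have "lift j (App M' Q') \<in> terms" "lift j (App P' Q') \<in> terms"
    using appL.hyps IH Q' by simp_all
  then have "App M' Q' \<rhd>\<^sub>\<beta> App P' Q'"
    using IH by (blast intro: beta.appL terms_liftD)
  then show ?case using IH Q' by (metis lift.simps(3))
next
  case (appR M P Q)
  obtain K' where "deg M = j # K'"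
    using terms_AppD(3)[OF appR.hyps(2)] appR.prems by (auto simp: prefix_def)
  then obtain M' P' where IH: "M = lift j M'" "P = lift j P'" "M' \<rhd>\<^sub>\<beta> P'"
    using appR.IH by blast
  obtain Q' where Q': "Q = lift j Q'"
    using terms_deg_Cons terms_AppD(1)[OF appR.hyps(2)] appR.prems by fastforce
  have "lift j (App Q' M') \<in> terms" "lift j (App Q' P') \<in> terms"
    using appR.hyps IH Q' by simp_all
  then have "App Q' M' \<rhd>\<^sub>\<beta> App Q' P'"
    using IH by (blast intro: beta.appR terms_liftD)
  then show ?case using IH Q' by (metis lift.simps(3))
qed


section \<open>Types and environments\<close>

lemma Inter_idem [simp]: "Inter U U = U"
  by transfer (rule teq.idem)

lemma Inter_comm: "tdeg U = tdeg V \<Longrightarrow> Inter U V = Inter V U"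
  by transfer (rule teq.comm)

lemma Inter_Omega_left: "tdeg U = L \<Longrightarrow> Inter (Omega L) U = U"
  by transfer (rule teq.omega_inter)

lemma Exp_Omega: "Exp i (Omega K) = Omega (i # K)"
  by transfer (rule teq.exp_omega)

lemma tdeg_simps [simp]:
  "tdeg (Atom a) = []" "tdeg (Arrow U T) = []" "tdeg (Omega L) = L"
  "tdeg (Inter U V) = tdeg U" "tdeg (Exp i U) = i # tdeg U"
  by (transfer, simp)+

lemma Inter_Omega_right: "tdeg U = L \<Longrightarrow> Inter U (Omega L) = U"
  using Inter_comm[of U "Omega L"] Inter_Omega_left[of U L] by simp

lemma tdeg_TT: "T \<in> TT \<Longrightarrow> tdeg T = []"
  by (erule TT.cases) auto

section \<open>Subtyping of environments as a pointwise relation\<close>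

lemma sub_UU: "U \<sqsubseteq> V \<Longrightarrow> U \<in> UU \<and> V \<in> UU \<and> tdeg U = tdeg V"
  by (induction rule: sub.induct) (auto intro: TT_UU.intros)

lemma sub_Inter_right: "\<lbrakk>U \<in> UU; V \<in> UU; tdeg U = tdeg V\<rbrakk> \<Longrightarrow> Inter U V \<sqsubseteq> V"
  using sub.inter_elim[of V U] Inter_comm[of U V] by simp

text \<open>Pointwise form of \<open>sub_env\<close>, which by itself changes one declaration at a
  time. Finiteness of the domain guarantees that finitely many such changes are enough.\<close>

definition env_le :: "('v, 'a) env \<Rightarrow> ('v, 'a) env \<Rightarrow> bool" where
  "env_le \<Gamma> \<Delta> \<longleftrightarrow> finite (dom \<Gamma>) \<and> dom \<Gamma> = dom \<Delta> \<and>
    (\<forall>v U V. \<Gamma> v = Some U \<longrightarrow> \<Delta> v = Some V \<longrightarrow> U \<sqsubseteq> V)"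

lemma sub_env_imp_le: "sub_env \<Gamma> \<Delta> \<Longrightarrow> env_le \<Gamma> \<Delta>"
proof (induction rule: sub_env.induct)
  case (refl \<Gamma>)
  then show ?case by (auto simp: env_le_def wf_env_def ran_def intro!: sub.refl)
next
  case (trans \<Gamma>\<^sub>1 \<Gamma>\<^sub>2 \<Gamma>\<^sub>3)
  show ?case
    unfolding env_le_def
  proof (intro conjI allI impI)
    fix v U W assume "\<Gamma>\<^sub>1 v = Some U" "\<Gamma>\<^sub>3 v = Some W"
    moreover from this obtain V where "\<Gamma>\<^sub>2 v = Some V"
      using trans.IH unfolding env_le_def by (metis domD domI)
    ultimately show "U \<sqsubseteq> W" using trans.IH unfolding env_le_def by (metis sub.trans)
  qed (use trans.IH in \<open>auto simp: env_le_def\<close>)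
next
  case (decl \<Gamma> y L U\<^sub>1 U\<^sub>2)
  then show "env_le (\<Gamma>((y, L) \<mapsto> U\<^sub>1)) (\<Gamma>((y, L) \<mapsto> U\<^sub>2))"
    by (auto simp: env_le_def wf_env_def ran_def intro!: sub.refl)
qed

lemma env_le_imp_sub_env:
  assumes "env_le \<Gamma> \<Delta>"
  shows "sub_env \<Gamma> \<Delta>"
proof -
  have le: "U \<sqsubseteq> V" if "\<Gamma> v = Some U" "\<Delta> v = Some V" for v U V
    using that assms unfolding env_le_def by blast
  have dom: "dom \<Gamma> = dom \<Delta>" and fin: "finite (dom \<Gamma>)" using assms unfolding env_le_def by auto
  have UU: "U \<in> UU" if "\<Gamma> v = Some U \<or> \<Delta> v = Some U" for v U
  proof -
    have "v \<in> dom \<Gamma>" "v \<in> dom \<Delta>" using that dom by auto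
    then obtain U' V' where "\<Gamma> v = Some U'" "\<Delta> v = Some V'" by blast
    then show ?thesis using that le sub_UU[of U' V'] by auto
  qed
  \<comment> \<open>Interpolates between the two environments: the declarations in \<open>S\<close>
    have already been replaced by those of \<open>\<Delta>\<close>.\<close>
  define upd where "upd = (\<lambda>S v. if v \<in> S then \<Delta> v else \<Gamma> v)"
  have dom_upd: "dom (upd S) = dom \<Gamma>" for S
    using dom by (auto simp: upd_def dom_def set_eq_iff)
  have wf: "wf_env (upd S)" for S
  proof -
    have "ran (upd S) \<subseteq> UU" using UU by (auto simp: ran_def upd_def split: if_splits)
    then show ?thesis using fin by (simp add: wf_env_def dom_upd)
  qed
  have "S \<subseteq> dom \<Gamma> \<longrightarrow> sub_env \<Gamma> (upd S)" if "finite S" for S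
    using that
  proof (induction S rule: finite_induct)
    case empty
    have "upd {} = \<Gamma>" by (auto simp: upd_def)
    then show ?case using sub_env.refl[OF wf, of "{}"] by simp
  next
    case (insert v S)
    show ?case
    proof
      assume *: "insert v S \<subseteq> dom \<Gamma>"
      obtain y L where v: "v = (y, L)" by (cases v)
      obtain U V where UV: "\<Gamma> v = Some U" "\<Delta> v = Some V" using * dom by fastforce
      \<comment> \<open>The rule for a single declaration requires the variable to be absent from
        the common part, hence it is removed first and then added with either type.\<close>
      let ?\<Theta> = "(upd S)(v := None)"
      have "wf_env ?\<Theta>" using wf[of S] by (auto simp: wf_env_def ran_def)
      then have "sub_env (?\<Theta>(v \<mapsto> U)) (?\<Theta>(v \<mapsto> V))"
        using le[OF UV] unfolding v by (intro sub_env.decl) auto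
      moreover have "?\<Theta>(v \<mapsto> U) = upd S"
        using insert.hyps UV by (auto simp: upd_def fun_eq_iff)
      moreover have "?\<Theta>(v \<mapsto> V) = upd (insert v S)"
        using UV by (auto simp: upd_def fun_eq_iff)
      ultimately show "sub_env \<Gamma> (upd (insert v S))"
        using insert.IH * by (auto intro: sub_env.trans)
    qed
  qed
  moreover have "upd (dom \<Gamma>) = \<Delta>"
    using dom by (auto simp: upd_def fun_eq_iff domIff)
  ultimately show ?thesis using fin by force
qed

lemma sub_typing_imp: "sub_typing \<Phi> \<Psi> \<Longrightarrow> snd \<Phi> \<sqsubseteq> snd \<Psi> \<and> sub_env (fst \<Psi>) (fst \<Phi>)"
  by (induction rule: sub_typing.induct) (auto intro: sub.intros sub_env.intros)

text \<open>Both components are transitive, so a chain of subtyping steps on typings collapses to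
  one pair, with the environments compared in the reverse direction.\<close>

lemma sub_typing_iff: "sub_typing (\<Gamma>, U) (\<Gamma>', U') \<longleftrightarrow> U \<sqsubseteq> U' \<and> env_le \<Gamma>' \<Gamma>"
  using sub_typing_imp[of "(\<Gamma>, U)" "(\<Gamma>', U')"] sub_typing.pair env_le_imp_sub_env sub_env_imp_le
  unfolding fst_conv snd_conv by metis

section \<open>Domains of the environment operations\<close>

lemma dom_env_omega [simp]: "dom (env_omega M) = fv M"
  by (auto simp: env_omega_def split: if_splits)

lemma dom_env_inter [simp]: "dom (env_inter \<Gamma> \<Delta>) = dom \<Gamma> \<union> dom \<Delta>"
  by (auto simp: env_inter_def domIff split: option.splits)

lemma env_exp_eq_Some:
  "env_exp j \<Gamma> (x, K) = Some V \<longleftrightarrow> (\<exists>L U. K = j # L \<and> \<Gamma> (x, L) = Some U \<and> V = Exp j U)"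
  by (cases K) (auto simp: env_exp_def)

lemma dom_env_exp: "dom (env_exp j \<Gamma>) = map_prod id ((#) j) ` dom \<Gamma>"
  by (force simp: dom_def env_exp_eq_Some)

lemma dom_env_up: "dom (env_up \<Gamma> M) = dom \<Gamma> \<union> fv M"
  by (auto simp: env_up_def)


section \<open>Typing\<close>

text \<open>The invariants depend on each other and are proved together. Equality of domain and free
  variables turns joinability of environments into joinability of terms; types in \<open>TT\<close>
  have the empty degree, a prefix of every index, as the formation of applications and abstractions
  demands.\<close>

lemma typing_legal:
  "M \<Colon> \<langle>\<Gamma> \<turnstile> U\<rangle> \<Longrightarrow> M \<in> terms \<and> dom \<Gamma> = fv M \<and> U \<in> UU \<and> tdeg U = deg M \<and>
    (\<forall>x L V. \<Gamma> (x, L) = Some V \<longrightarrow> V \<in> UU \<and> tdeg V = L)"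
proof (induction rule: typing.induct)
  case (ax T x)
  then show ?case by (auto simp: tdeg_TT intro: terms.var TT_UU.intros split: if_splits)
next
  case (omega M)
  then show ?case by (auto simp: env_omega_def intro: TT_UU.intros split: if_splits)
next
  case (arrI M \<Gamma> x L U T)
  have "dom (\<Gamma>((x, L) \<mapsto> U)) = fv M" using arrI.IH by blast
  then have dom: "insert (x, L) (dom \<Gamma>) = fv M" by simp
  have "U \<in> UU" using arrI.IH by (metis fun_upd_same)
  moreover have "dom \<Gamma> = fv M - {(x, L)}" using dom arrI.hyps by auto
  moreover have "V \<in> UU \<and> tdeg V = K" if "\<Gamma> (y, K) = Some V" for y K V
    using arrI.IH arrI.hyps that by (metis domI fun_upd_other)
  moreover have "deg M = []" using arrI by (simp add: tdeg_TT)
  ultimately show ?case using arrI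
    by (auto simp: fv_Abs deg_Abs intro: terms.abs TT_UU.intros)
next
  case (arrI' M \<Gamma> T x L)
  moreover from this have "deg M = []" by (simp add: tdeg_TT)
  ultimately show ?case
    by (auto simp: fv_Abs deg_Abs intro: terms.abs TT_UU.intros)
next
  case (arrE M\<^sub>1 \<Gamma>\<^sub>1 U T M\<^sub>2 \<Gamma>\<^sub>2)
  then have deg: "deg M\<^sub>1 = []" "tdeg T = []" using tdeg_TT by auto
  have "V \<in> UU \<and> tdeg V = K" if "env_inter \<Gamma>\<^sub>1 \<Gamma>\<^sub>2 (y, K) = Some V" for y K V
    using that arrE.IH
    by (auto simp: env_inter_def split: option.splits intro: TT_UU.intros)
  then show ?case using arrE deg
    by (auto intro!: terms.app TT_UU.intros)
next
  case (interI M \<Gamma> U\<^sub>1 U\<^sub>2)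
  then show ?case by (auto intro: TT_UU.intros)
next
  case (exp M \<Gamma> U j)
  then show ?case
    by (auto simp: terms_lift dom_env_exp fv_lift env_exp_eq_Some intro: TT_UU.intros)
next
  case (sub M \<Gamma> U \<Gamma>' U')
  then have le: "U \<sqsubseteq> U'" "env_le \<Gamma>' \<Gamma>" by (simp_all add: sub_typing_iff)
  have "V \<in> UU \<and> tdeg V = K" if "\<Gamma>' (y, K) = Some V" for y K V
  proof -
    have "(y, K) \<in> dom \<Gamma>" using le that by (auto simp: env_le_def)
    then obtain W where W: "\<Gamma> (y, K) = Some W" by blast
    then have "V \<sqsubseteq> W" using le that by (auto simp: env_le_def)
    then show ?thesis using sub.IH W sub_UU[of V W] by auto
  qed
  then show ?case using sub.IH le sub_UU[OF le(1)] by (auto simp: env_le_def)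
qed

lemma typing_terms: "M \<Colon> \<langle>\<Gamma> \<turnstile> U\<rangle> \<Longrightarrow> M \<in> terms"
  and typing_dom: "M \<Colon> \<langle>\<Gamma> \<turnstile> U\<rangle> \<Longrightarrow> dom \<Gamma> = fv M"
  and typing_UU: "M \<Colon> \<langle>\<Gamma> \<turnstile> U\<rangle> \<Longrightarrow> U \<in> UU"
  and typing_tdeg: "M \<Colon> \<langle>\<Gamma> \<turnstile> U\<rangle> \<Longrightarrow> tdeg U = deg M"
  and typing_env: "M \<Colon> \<langle>\<Gamma> \<turnstile> U\<rangle> \<Longrightarrow> \<Gamma> (x, L) = Some V \<Longrightarrow> V \<in> UU \<and> tdeg V = L"
  using typing_legal by blast+

lemma env_le_refl: "M \<Colon> \<langle>\<Gamma> \<turnstile> U\<rangle> \<Longrightarrow> env_le \<Gamma> \<Gamma>"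
  using typing_env finite_fv[of M] typing_dom by (fastforce simp: env_le_def intro: sub.refl)

lemma typing_weaken:
  assumes "M \<Colon> \<langle>\<Gamma> \<turnstile> U\<rangle>" "dom \<Gamma>' = fv M"
    and "\<And>v V V'. v \<in> fv M \<Longrightarrow> \<Gamma> v = Some V \<Longrightarrow> \<Gamma>' v = Some V' \<Longrightarrow> V' \<sqsubseteq> V"
  shows "M \<Colon> \<langle>\<Gamma>' \<turnstile> U\<rangle>"
proof -
  have "env_le \<Gamma>' \<Gamma>"
    using assms typing_dom[OF assms(1)] finite_fv[of M] unfolding env_le_def by (metis domI)
  then show ?thesis
    using typing.sub[OF assms(1), of \<Gamma>' U] typing_UU[OF assms(1)]
    by (simp add: sub_typing_iff sub.refl)
qed


subsection \<open>Induction with fresh binders\<close>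

text \<open>A partial map is renamed by precomposition with the inverse; therefore typings are
  renamed by bijections, whereas injections are enough for terms.\<close>

definition env_ren :: "('v \<Rightarrow> 'v) \<Rightarrow> ('v, 'a) env \<Rightarrow> ('v, 'a) env" where
  "env_ren f \<Gamma> = (\<lambda>(x, L). \<Gamma> (inv f x, L))"

lemma env_ren_apply [simp]: "env_ren f \<Gamma> (x, L) = \<Gamma> (inv f x, L)"
  by (simp add: env_ren_def)

lemma dom_env_ren: "bij f \<Longrightarrow> dom (env_ren f \<Gamma>) = map_prod f id ` dom \<Gamma>"
proof -
  assume "bij f"
  then have "f (inv f x) = x" "inv f (f x) = x" for x
    by (simp_all add: bij_is_surj surj_f_inv_f bij_is_inj)
  then show ?thesis by (force simp: dom_def image_iff)
qed

lemma env_ren_upd: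
  assumes "bij f"
  shows "env_ren f (\<Gamma>((x, L) \<mapsto> U)) = (env_ren f \<Gamma>)((f x, L) \<mapsto> U)"
  using assms by (auto simp: fun_eq_iff bij_is_inj bij_inv_eq_iff)

lemma env_ren_empty [simp]: "env_ren f Map.empty = Map.empty"
  by auto

lemma env_ren_omega: "bij f \<Longrightarrow> env_omega (map_trm f M) = env_ren f (env_omega M)"
proof -
  assume "bij f"
  then have "f (inv f x) = x" "inv f (f x) = x" for x
    by (simp_all add: bij_is_surj surj_f_inv_f bij_is_inj)
  then have "(x, L) \<in> fv (map_trm f M) \<longleftrightarrow> (inv f x, L) \<in> fv M" for x L
    unfolding fv_map_trm image_iff by (metis (no_types, lifting) id_apply map_prod_simp prod.exhaust prod.inject)
  then show ?thesis by (auto simp: env_omega_def)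
qed

lemma env_ren_inter: "env_ren f (env_inter \<Gamma> \<Delta>) = env_inter (env_ren f \<Gamma>) (env_ren f \<Delta>)"
  by (auto simp: env_inter_def fun_eq_iff split: option.splits)

lemma env_ren_exp: "env_ren f (env_exp j \<Gamma>) = env_exp j (env_ren f \<Gamma>)"
  by (auto simp: env_exp_def fun_eq_iff split: list.splits)

lemma env_le_ren: "bij f \<Longrightarrow> env_le \<Gamma> \<Delta> \<Longrightarrow> env_le (env_ren f \<Gamma>) (env_ren f \<Delta>)"
  by (auto simp: env_le_def dom_env_ren)

lemma notin_dom_env_ren: "bij f \<Longrightarrow> (x, L) \<notin> dom \<Gamma> \<Longrightarrow> (f x, L) \<notin> dom (env_ren f \<Gamma>)"
  by (auto simp: bij_is_inj)

text \<open>No rule distinguishes particular names, so a bijective renaming carries each rule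
  instance to another instance of the same rule.\<close>

lemma typing_map_trm: "M \<Colon> \<langle>\<Gamma> \<turnstile> U\<rangle> \<Longrightarrow> bij f \<Longrightarrow> map_trm f M \<Colon> \<langle>env_ren f \<Gamma> \<turnstile> U\<rangle>"
proof (induction rule: typing.induct)
  case (ax T x)
  then show "map_trm f (Var x []) \<Colon> \<langle>env_ren f [(x, []) \<mapsto> T] \<turnstile> T\<rangle>"
    by (simp add: env_ren_upd typing.ax)
next
  case (omega M)
  then show ?case
    using typing.omega[OF terms_map_trm[OF omega(1)], of f]
    by (simp add: env_ren_omega bij_is_inj)
next
  case (arrI M \<Gamma> x L U T)
  then show ?case
    using typing.arrI[of "map_trm f M" "env_ren f \<Gamma>" "f x" L U T] notin_dom_env_ren[of f x L \<Gamma>]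
      arrI.IH[unfolded env_ren_upd[OF arrI.prems]]
    by (simp add: Abs_map_trm bij_is_inj del: fun_upd_apply)
next
  case (arrI' M \<Gamma> T x L)
  then show ?case
    using notin_dom_env_ren[of f x L \<Gamma>]
    by (auto simp: Abs_map_trm bij_is_inj intro!: typing.arrI')
next
  case (arrE M\<^sub>1 \<Gamma>\<^sub>1 U T M\<^sub>2 \<Gamma>\<^sub>2)
  then show ?case
    by (auto simp: env_ren_inter dom_env_ren joinable_map bij_is_inj intro!: typing.arrE)
next
  case (interI M \<Gamma> U\<^sub>1 U\<^sub>2)
  then show ?case by (simp add: typing.interI)
next
  case (exp M \<Gamma> U j)
  then show ?case by (simp add: env_ren_exp lift_map_trm[symmetric] typing.exp)
next
  case (sub M \<Gamma> U \<Gamma>' U')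
  then show ?case by (auto simp: sub_typing_iff env_le_ren intro: typing.sub)
qed

text \<open>The variable convention as an induction rule: bound names avoid the finite set
  \<open>C\<close>. The induction hypotheses hold for every finite set, so the names to be avoided
  can be chosen anew when a binder is opened.\<close>

lemma typing_fresh_induct [consumes 2, case_names ax omega arrI arrI' arrE interI exp sub]:
  fixes M :: "'v::infinite trm" and \<Gamma> :: "('v, 'a) env"
    and P :: "'v set \<Rightarrow> 'v trm \<Rightarrow> ('v, 'a) env \<Rightarrow> 'a ty \<Rightarrow> bool"
  assumes "M \<Colon> \<langle>\<Gamma> \<turnstile> U\<rangle>" and "finite C"
    and ax: "\<And>C T x. T \<in> TT \<Longrightarrow> finite C \<Longrightarrow> P C (Var x []) [(x, []) \<mapsto> T] T"
    and omega: "\<And>C M. M \<in> terms \<Longrightarrow> finite C \<Longrightarrow> P C M (env_omega M) (Omega (deg M))"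
    and arrI: "\<And>C M \<Gamma> x L U T. \<lbrakk>M \<Colon> \<langle>\<Gamma>((x, L) \<mapsto> U) \<turnstile> T\<rangle>; (x, L) \<notin> dom \<Gamma>; T \<in> TT; finite C; x \<notin> C;
        \<And>C. finite C \<Longrightarrow> P C M (\<Gamma>((x, L) \<mapsto> U)) T\<rbrakk> \<Longrightarrow> P C (Abs x L M) \<Gamma> (Arrow U T)"
    and arrI': "\<And>C M \<Gamma> x L T. \<lbrakk>M \<Colon> \<langle>\<Gamma> \<turnstile> T\<rangle>; (x, L) \<notin> dom \<Gamma>; T \<in> TT; finite C; x \<notin> C;
        \<And>C. finite C \<Longrightarrow> P C M \<Gamma> T\<rbrakk> \<Longrightarrow> P C (Abs x L M) \<Gamma> (Arrow (Omega L) T)"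
    and arrE: "\<And>C M\<^sub>1 \<Gamma>\<^sub>1 U T M\<^sub>2 \<Gamma>\<^sub>2. \<lbrakk>M\<^sub>1 \<Colon> \<langle>\<Gamma>\<^sub>1 \<turnstile> Arrow U T\<rangle>; M\<^sub>2 \<Colon> \<langle>\<Gamma>\<^sub>2 \<turnstile> U\<rangle>; env_join \<Gamma>\<^sub>1 \<Gamma>\<^sub>2;
        U \<in> UU; T \<in> TT; finite C; \<And>C. finite C \<Longrightarrow> P C M\<^sub>1 \<Gamma>\<^sub>1 (Arrow U T);
        \<And>C. finite C \<Longrightarrow> P C M\<^sub>2 \<Gamma>\<^sub>2 U\<rbrakk> \<Longrightarrow> P C (App M\<^sub>1 M\<^sub>2) (env_inter \<Gamma>\<^sub>1 \<Gamma>\<^sub>2) T"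
    and interI: "\<And>C M \<Gamma> U\<^sub>1 U\<^sub>2. \<lbrakk>M \<Colon> \<langle>\<Gamma> \<turnstile> U\<^sub>1\<rangle>; M \<Colon> \<langle>\<Gamma> \<turnstile> U\<^sub>2\<rangle>; finite C;
        \<And>C. finite C \<Longrightarrow> P C M \<Gamma> U\<^sub>1; \<And>C. finite C \<Longrightarrow> P C M \<Gamma> U\<^sub>2\<rbrakk> \<Longrightarrow> P C M \<Gamma> (Inter U\<^sub>1 U\<^sub>2)"
    and exp: "\<And>C M \<Gamma> U j. \<lbrakk>M \<Colon> \<langle>\<Gamma> \<turnstile> U\<rangle>; finite C; \<And>C. finite C \<Longrightarrow> P C M \<Gamma> U\<rbrakk>
        \<Longrightarrow> P C (lift j M) (env_exp j \<Gamma>) (Exp j U)"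
    and sub: "\<And>C M \<Gamma> U \<Gamma>' U'. \<lbrakk>M \<Colon> \<langle>\<Gamma> \<turnstile> U\<rangle>; env_le \<Gamma>' \<Gamma>; U \<sqsubseteq> U'; finite C;
        \<And>C. finite C \<Longrightarrow> P C M \<Gamma> U\<rbrakk> \<Longrightarrow> P C M \<Gamma>' U'"
  shows "P C M \<Gamma> U"
proof -
  \<comment> \<open>Quantifying over all renamings \<open>f\<close> makes the induction hypothesis
    available for the body with its bound name exchanged; \<open>f = id\<close> gives the
    claim.\<close>
  have "P C (map_trm f M) (env_ren f \<Gamma>) U" if "bij f" "finite C" for f C
    using assms(1) that
  proof (induction arbitrary: f C rule: typing.induct)
    case (ax T x)
    then show "P C (map_trm f (Var x [])) (env_ren f [(x, []) \<mapsto> T]) T"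
      by (simp add: env_ren_upd assms(3))
  next
    case (omega M)
    then show ?case
      using assms(4)[OF terms_map_trm[OF omega(1)], of f]
      by (simp add: env_ren_omega bij_is_inj)
  next
    case (arrI M \<Gamma> x L U T)
    have tyM: "map_trm f M \<Colon> \<langle>(env_ren f \<Gamma>)((f x, L) \<mapsto> U) \<turnstile> T\<rangle>"
      using typing_map_trm[OF arrI.hyps(1) arrI.prems(1)] unfolding env_ren_upd[OF arrI.prems(1)] .
    obtain y where y: "y \<notin> C" "\<And>K. (y, K) \<notin> fv (map_trm f M)"
      using ex_fresh_name[OF finite_fv arrI.prems(2)] by metis
    have dom: "insert (f x, L) (dom (env_ren f \<Gamma>)) = fv (map_trm f M)"
      using typing_dom[OF tyM] by simp
    have index: "K = L" if "(f x, K) \<in> fv (map_trm f M)" for K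
      using terms_self_joinable[OF typing_terms[OF tyM]] dom that unfolding joinable_def by blast
    let ?t = "transpose (f x) y"
    have bij: "bij (?t \<circ> f)" using arrI.prems by (simp add: bij_comp)
    \<comment> \<open>Exchanging \<open>f x\<close> and \<open>y\<close> does not affect the
      environment of the abstraction. Neither name is declared there at any index:
      \<open>f x\<close> could occur only with index \<open>L\<close>, which is the bound variable
      itself, and \<open>y\<close> is fresh.\<close>
    have t: "env_ren (?t \<circ> f) \<Gamma> = env_ren f \<Gamma>"
    proof
      fix v :: "'v ivar"
      obtain z K where v: "v = (z, K)" by (cases v)
      have inv: "inv (?t \<circ> f) z = inv f (?t z)"
        using arrI.prems by (simp add: o_inv_distrib)
      have "(f x, L) \<notin> dom (env_ren f \<Gamma>)"
        using arrI by (intro notin_dom_env_ren) auto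
      then have "(f x, K) \<notin> dom (env_ren f \<Gamma>)" "(y, K) \<notin> dom (env_ren f \<Gamma>)"
        using index[of K] y(2)[of K] dom by blast+
      then show "env_ren (?t \<circ> f) \<Gamma> v = env_ren f \<Gamma> v"
        unfolding v by (auto simp: inv transpose_def domIff)
    qed
    have upd: "env_ren (?t \<circ> f) (\<Gamma>((x, L) \<mapsto> U)) = (env_ren f \<Gamma>)((y, L) \<mapsto> U)"
      by (simp add: env_ren_upd[OF bij] t)
    have map: "map_trm (?t \<circ> f) M = map_trm ?t (map_trm f M)"
      by (simp add: trm.map_comp)
    have "P C (Abs y L (map_trm (?t \<circ> f) M)) (env_ren f \<Gamma>) (Arrow U T)"
    proof (rule assms(5))
      show "map_trm (?t \<circ> f) M \<Colon> \<langle>(env_ren f \<Gamma>)((y, L) \<mapsto> U) \<turnstile> T\<rangle>"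
        using typing_map_trm[OF arrI.hyps(1) bij] unfolding upd .
      show "(y, L) \<notin> dom (env_ren f \<Gamma>)" using y(2) dom by blast
      show "P C (map_trm (?t \<circ> f) M) ((env_ren f \<Gamma>)((y, L) \<mapsto> U)) T" if "finite C" for C
        using arrI.IH[OF bij that] unfolding upd .
    qed (use arrI y in auto)
    moreover have "Abs (f x) L (map_trm f M) = Abs y L (map_trm (?t \<circ> f) M)"
      unfolding map by (rule Abs_transpose) (use index y in auto)
    ultimately show ?case using arrI.prems by (simp add: Abs_map_trm bij_is_inj)
  next
    case (arrI' M \<Gamma> T x L)
    note tyM = typing_map_trm[OF arrI'.hyps(1) arrI'.prems(1)]
    obtain y where y: "y \<notin> C" "\<And>K. (y, K) \<notin> fv (map_trm f M)"
      using ex_fresh_name[OF finite_fv arrI'.prems(2)] by metis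
    \<comment> \<open>The bound variable does not occur, so the binder takes the name
      \<open>y\<close> while the body stays as it is.\<close>
    have "(f x, L) \<notin> fv (map_trm f M)"
      using typing_dom[OF tyM] arrI' notin_dom_env_ren by metis
    then have "Abs (f x) L (map_trm f M) = Abs y L (map_trm f M)"
      using y by (simp add: Abs_def close_fresh)
    moreover have "P C (Abs y L (map_trm f M)) (env_ren f \<Gamma>) (Arrow (Omega L) T)"
      using arrI' tyM y typing_dom[OF tyM] by (intro assms(6)) auto
    ultimately show ?case using arrI'.prems by (simp add: Abs_map_trm bij_is_inj)
  next
    case (arrE M\<^sub>1 \<Gamma>\<^sub>1 U T M\<^sub>2 \<Gamma>\<^sub>2)
    have "env_join (env_ren f \<Gamma>\<^sub>1) (env_ren f \<Gamma>\<^sub>2)"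
      using arrE by (simp add: dom_env_ren joinable_map bij_is_inj)
    then show ?case
      using arrE by (auto simp: env_ren_inter intro!: assms(7) typing_map_trm)
  next
    case (interI M \<Gamma> U\<^sub>1 U\<^sub>2)
    then show ?case by (auto intro!: assms(8) typing_map_trm)
  next
    case (exp M \<Gamma> U j)
    then show ?case
      by (auto simp: env_ren_exp lift_map_trm[symmetric] intro!: assms(9) typing_map_trm)
  next
    case (sub M \<Gamma> U \<Gamma>' U')
    have "env_le (env_ren f \<Gamma>') (env_ren f \<Gamma>)" "U \<sqsubseteq> U'"
      using sub by (simp_all add: sub_typing_iff env_le_ren)
    from assms(10)[OF typing_map_trm[OF sub.hyps(1) sub.prems(1)] this sub.prems(2) sub.IH]
    show ?case using sub.prems(1) by blast
  qed
  from this[of id C] show ?thesis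
    using assms(2) by (simp add: trm.map_id0 env_ren_def)
qed


section \<open>Subject expansion\<close>

lemma restrict_dom: "dom \<Gamma> = A \<Longrightarrow> \<Gamma> |` A = \<Gamma>"
  by (rule ext) (auto simp: restrict_map_def domIff)

text \<open>Declarations shared by both restrictions are equal and merge by idempotence. Thus both
  parts of an application can be typed in one environment.\<close>

lemma env_inter_restrict: "env_inter (\<Gamma> |` A) (\<Gamma> |` B) = \<Gamma> |` (A \<union> B)"
  by (auto simp: env_inter_def restrict_map_def fun_eq_iff split: option.splits)

lemma typing_App_restrict:
  assumes "M \<Colon> \<langle>\<Gamma> |` fv M \<turnstile> Arrow U T\<rangle>" "N \<Colon> \<langle>\<Gamma> |` fv N \<turnstile> U\<rangle>" "M \<diamondop> N" "T \<in> TT"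
  shows "App M N \<Colon> \<langle>\<Gamma> |` fv (App M N) \<turnstile> T\<rangle>"
  using typing.arrE[OF assms(1,2) _ typing_UU[OF assms(2)] assms(4)] assms(3)
    typing_dom[OF assms(1)] typing_dom[OF assms(2)]
  by (simp add: env_inter_restrict)

lemma env_inter_le1:
  assumes "M \<Colon> \<langle>\<Gamma> \<turnstile> U\<rangle>" "N \<Colon> \<langle>\<Delta> \<turnstile> V\<rangle>" "\<Gamma> v = Some W" "env_inter \<Gamma> \<Delta> v = Some W'"
  shows "W' \<sqsubseteq> W"
  using assms(3,4) typing_env[OF assms(1)] typing_env[OF assms(2)]
  by (cases v) (auto simp: env_inter_def split: option.splits intro!: sub.inter_elim intro: sub.refl)

lemma env_inter_le2:
  assumes "M \<Colon> \<langle>\<Gamma> \<turnstile> U\<rangle>" "N \<Colon> \<langle>\<Delta> \<turnstile> V\<rangle>" "\<Delta> v = Some W" "env_inter \<Gamma> \<Delta> v = Some W'"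
  shows "W' \<sqsubseteq> W"
  using assms(3,4) typing_env[OF assms(1)] typing_env[OF assms(2)]
  by (cases v) (auto simp: env_inter_def split: option.splits intro!: sub_Inter_right intro: sub.refl)

lemma typing_weaken_restrict:
  assumes "M \<Colon> \<langle>\<Gamma> |` fv M \<turnstile> U\<rangle>" "fv M \<subseteq> dom \<Gamma>'"
    and "\<And>v V V'. \<Gamma> v = Some V \<Longrightarrow> \<Gamma>' v = Some V' \<Longrightarrow> V' \<sqsubseteq> V"
  shows "M \<Colon> \<langle>\<Gamma>' |` fv M \<turnstile> U\<rangle>"
  using assms(1) by (rule typing_weaken) (use assms in \<open>auto simp: restrict_map_def split: if_splits\<close>)

text \<open>A typing of \<open>M[x\<^sup>L := N]\<close> is to be split into one of \<open>M\<close> and one of \<open>N\<close>. The types of an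
  environment may always be replaced by subtypes, so both parts can use the given environment,
  restricted to their free variables, instead of two environments whose intersection it refines.\<close>

definition splits_at ::
  "('v, 'a) env \<Rightarrow> 'a ty \<Rightarrow> 'v \<Rightarrow> index \<Rightarrow> 'v trm \<Rightarrow> 'v trm \<Rightarrow> bool" where
  "splits_at \<Gamma> U x L N M \<longleftrightarrow>
    (\<exists>V. M \<Colon> \<langle>(\<Gamma>((x, L) \<mapsto> V)) |` fv M \<turnstile> U\<rangle> \<and> N \<Colon> \<langle>\<Gamma> |` fv N \<turnstile> V\<rangle>)"

text \<open>The type collected for \<open>x^L\<close> is \<open>T\<close> itself. A type in
  \<open>TT\<close> has the empty degree, which forces \<open>L = []\<close>, the only index at
  which the axiom types a variable.\<close>

lemma splits_at_Var:
  assumes "N \<Colon> \<langle>\<Gamma> \<turnstile> T\<rangle>" "T \<in> TT" "deg N = L"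
  shows "splits_at \<Gamma> T x L N (Var x L)"
proof -
  have "L = []" using typing_tdeg[OF assms(1)] tdeg_TT[OF assms(2)] assms(3) by simp
  moreover have "(\<Gamma>((x, []) \<mapsto> T)) |` {(x, [])} = [(x, []) \<mapsto> T]"
    by (auto simp: restrict_map_def fun_eq_iff)
  ultimately have "Var x L \<Colon> \<langle>(\<Gamma>((x, L) \<mapsto> T)) |` fv (Var x L) \<turnstile> T\<rangle>"
    using typing.ax[OF assms(2)] by simp
  then show ?thesis
    using assms(1) restrict_dom[OF typing_dom[OF assms(1)]] unfolding splits_at_def by auto
qed

text \<open>The type collected for \<open>x^L\<close> is kept. This moves splittings of the two
  parts of an application into their intersected environment.\<close>

lemma splits_at_weaken:
  assumes "splits_at \<Gamma> U x L N M" "fv M - {(x, L)} \<subseteq> dom \<Gamma>'" "fv N \<subseteq> dom \<Gamma>'" "U \<sqsubseteq> U'"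
    and le: "\<And>v V V'. \<Gamma> v = Some V \<Longrightarrow> \<Gamma>' v = Some V' \<Longrightarrow> V' \<sqsubseteq> V"
  shows "splits_at \<Gamma>' U' x L N M"
proof -
  obtain V where V: "M \<Colon> \<langle>(\<Gamma>((x, L) \<mapsto> V)) |` fv M \<turnstile> U\<rangle>" "N \<Colon> \<langle>\<Gamma> |` fv N \<turnstile> V\<rangle>"
    using assms(1) unfolding splits_at_def by blast
  have M: "M \<Colon> \<langle>(\<Gamma>'((x, L) \<mapsto> V)) |` fv M \<turnstile> U\<rangle>"
    by (rule typing_weaken_restrict[OF V(1)])
      (use assms(2) le typing_UU[OF V(2)] in \<open>auto simp: sub.refl split: if_splits\<close>)
  have "M \<Colon> \<langle>(\<Gamma>'((x, L) \<mapsto> V)) |` fv M \<turnstile> U'\<rangle>"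
    by (rule typing.sub[OF M]) (simp only: sub_typing_iff assms(4) env_le_refl[OF M])
  moreover have "N \<Colon> \<langle>\<Gamma>' |` fv N \<turnstile> V\<rangle>"
    by (rule typing_weaken_restrict[OF V(2) assms(3)]) (use le in auto)
  ultimately show ?thesis unfolding splits_at_def by blast
qed

section \<open>Changing the type of the substituted variable\<close>

lemma typing_weaken_fresh_upd:
  assumes "M \<Colon> \<langle>\<Gamma> \<turnstile> U\<rangle>" "(x, L) \<notin> fv M" "fv M \<subseteq> dom \<Gamma>'"
    and "\<And>v V V'. \<Gamma> v = Some V \<Longrightarrow> \<Gamma>' v = Some V' \<Longrightarrow> V' \<sqsubseteq> V"
  shows "M \<Colon> \<langle>(\<Gamma>'((x, L) \<mapsto> V)) |` fv M \<turnstile> U\<rangle>"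
  using assms(1) by (rule typing_weaken)
    (use assms in \<open>auto simp: restrict_map_def split: if_splits\<close>)

lemma typing_weaken_upd:
  assumes "M \<Colon> \<langle>(\<Gamma>((x, L) \<mapsto> V)) |` fv M \<turnstile> U\<rangle>" "W \<sqsubseteq> V" "fv M - {(x, L)} \<subseteq> dom \<Gamma>"
    shows "M \<Colon> \<langle>(\<Gamma>((x, L) \<mapsto> W)) |` fv M \<turnstile> U\<rangle>"
proof (rule typing_weaken[OF assms(1)])
  show "dom ((\<Gamma>((x, L) \<mapsto> W)) |` fv M) = fv M" using assms(3) by auto
next
  fix v A B
  assume "v \<in> fv M" and A: "((\<Gamma>((x, L) \<mapsto> V)) |` fv M) v = Some A"
    and "((\<Gamma>((x, L) \<mapsto> W)) |` fv M) v = Some B"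
  then show "B \<sqsubseteq> A"
    using assms(2) typing_env[OF assms(1), of "fst v" "snd v" A]
    by (auto simp: restrict_map_def intro: sub.refl split: if_splits)
qed

text \<open>Merges two splittings: the intersection is a subtype of both collected types, and
  \<open>N\<close> has it by the intersection rule.\<close>

lemma typing_upd_Inter:
  assumes "M \<Colon> \<langle>(\<Gamma>((x, L) \<mapsto> V)) |` fv M \<turnstile> U\<rangle>" "N \<Colon> \<langle>\<Gamma> |` fv N \<turnstile> V\<rangle>"
    and "M' \<Colon> \<langle>(\<Gamma>((x, L) \<mapsto> V')) |` fv M' \<turnstile> U'\<rangle>" "N \<Colon> \<langle>\<Gamma> |` fv N \<turnstile> V'\<rangle>"
    and "fv M - {(x, L)} \<subseteq> dom \<Gamma>" "fv M' - {(x, L)} \<subseteq> dom \<Gamma>"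
  shows "M \<Colon> \<langle>(\<Gamma>((x, L) \<mapsto> Inter V V')) |` fv M \<turnstile> U\<rangle>"
    "M' \<Colon> \<langle>(\<Gamma>((x, L) \<mapsto> Inter V V')) |` fv M' \<turnstile> U'\<rangle>"
    "N \<Colon> \<langle>\<Gamma> |` fv N \<turnstile> Inter V V'\<rangle>"
proof -
  have "V \<in> UU" "V' \<in> UU" "tdeg V = tdeg V'"
    using assms(2,4) typing_UU typing_tdeg by metis+
  then have "Inter V V' \<sqsubseteq> V" "Inter V V' \<sqsubseteq> V'" by (simp_all add: sub.inter_elim sub_Inter_right)
  then show "M \<Colon> \<langle>(\<Gamma>((x, L) \<mapsto> Inter V V')) |` fv M \<turnstile> U\<rangle>"
    "M' \<Colon> \<langle>(\<Gamma>((x, L) \<mapsto> Inter V V')) |` fv M' \<turnstile> U'\<rangle>"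
    using typing_weaken_upd[OF assms(1) _ assms(5)] typing_weaken_upd[OF assms(3) _ assms(6)]
    by simp_all
  show "N \<Colon> \<langle>\<Gamma> |` fv N \<turnstile> Inter V V'\<rangle>" using assms(2,4) by (rule typing.interI)
qed

text \<open>An abstraction arises by substitution either as a copy of \<open>N\<close> or from an
  abstraction in \<open>M\<close>. In the second case the binder is opened at \<open>y\<close>,
  which is fresh for \<open>M\<close> and \<open>N\<close>, so the substitution passes under it and
  \<open>Abs\<close> can be cancelled.\<close>

lemma subst_eq_AbsE:
  assumes "Abs y K P = subst x L N M" "M \<in> terms" "N \<in> terms" "P \<in> terms" "M \<diamondop> N"
    and "(x, L) \<in> fv M" "y \<noteq> x" "\<And>J. (y, J) \<notin> fv M" "\<And>J. (y, J) \<notin> fv N"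
  obtains (Var) "M = Var x L" "N = Abs y K P"
    | (Abs) M' where "M = Abs y K M'" "M' \<in> terms" "P = subst x L N M'" "M' \<diamondop> N" "(x, L) \<in> fv M'"
proof (cases M)
  case (Var z J)
  then show thesis using that(1) assms(1,6) by simp
next
  case (Lam J M1)
  with assms(1) have [simp]: "J = K" by (simp add: Abs_def)
  have "(y, J) \<notin> fv M1" for J using assms(8) Lam by simp
  then obtain M' where M': "M = Abs y K M'" "M' \<in> terms"
    using terms_LamE[of K M1 y] assms(2) Lam by (metis \<open>J = K\<close>)
  have "Abs y K P = Abs y K (subst x L N M')"
    using assms(1,7,9) M' by (simp add: subst_Abs)
  then have "P = subst x L N M'"
    using assms(3,4) M' by (intro Abs_inject[of P _ y K])
      (auto intro: terms_locally_closed locally_closed_subst)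
  \<comment> \<open>Opening the binder can only add \<open>y^K\<close> to the free variables, and
    \<open>y\<close> is not free in \<open>N\<close> at any index.\<close>
  moreover have "M' \<diamondop> N"
    using assms(5,9) M' unfolding joinable_def by (auto simp: fv_Abs)
  ultimately show thesis using that(2) M' assms(6) by (simp add: fv_Abs)
qed (use assms in \<open>auto simp: Abs_def\<close>)

text \<open>Since \<open>x^L\<close> occurs in \<open>M\<close>, all free variables of
  \<open>N\<close> are declared in \<Gamma>, so its restriction can type \<open>N\<close>. The set
  \<open>C\<close> keeps the binders of the derivation apart from \<open>x\<close> and from the free
  names of \<open>M\<close> and \<open>N\<close>.\<close>

lemma typing_subst_splits:
  fixes P :: "'v::infinite trm" and \<Gamma> :: "('v, 'a) env"
  shows "\<lbrakk>P \<Colon> \<langle>\<Gamma> \<turnstile> U\<rangle>; finite C; P = subst x L N M; M \<in> terms; N \<in> terms; M \<diamondop> N; deg N = L;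
    (x, L) \<in> fv M; insert x (fst ` (fv M \<union> fv N)) \<subseteq> C\<rbrakk> \<Longrightarrow> splits_at \<Gamma> U x L N M"
proof (induction arbitrary: x L N M rule: typing_fresh_induct)
  case (ax C T y)
  then have "M = Var x L" by (cases M) auto
  moreover from this have "N = Var y []" using ax by simp
  ultimately show "splits_at [(y, []) \<mapsto> T] T x L N M"
    using splits_at_Var[OF typing.ax[OF ax(1), of y] ax(1), of L x] ax by simp
next
  case (omega C P)
  have fv: "fv P = (fv M - {(x, L)}) \<union> fv N" using omega fv_subst by metis
  \<comment> \<open>The collected type is \<omega> at index \<open>L\<close>: with it both
    restricted environments become the \<omega>-environments of \<open>M\<close> and
    \<open>N\<close>.\<close>
  have "((env_omega P)((x, L) \<mapsto> Omega L)) |` fv M = (env_omega M :: ('v, 'a) env)"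
    using fv \<open>(x, L) \<in> fv M\<close> by (auto simp: env_omega_def restrict_map_def fun_eq_iff)
  moreover have "env_omega P |` fv N = (env_omega N :: ('v, 'a) env)"
    using fv by (auto simp: env_omega_def restrict_map_def fun_eq_iff)
  moreover have "deg P = deg M" using omega deg_subst by metis
  ultimately show ?case
    using typing.omega[of M] typing.omega[of N] omega
    unfolding splits_at_def by (intro exI[of _ "Omega L"]) auto
next
  case (arrI C P \<Gamma> y K U T)
  have fresh: "y \<noteq> x" "\<And>J. (y, J) \<notin> fv M" "\<And>J. (y, J) \<notin> fv N"
    using arrI.hyps(5) arrI.prems(7) by force+
  show ?case
    using arrI.prems(1-3) typing_terms[OF arrI.hyps(1)] arrI.prems(4,6) fresh
  proof (cases rule: subst_eq_AbsE)
    case Var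
    then show ?thesis
      using splits_at_Var[of N \<Gamma> "Arrow U T" L x] typing.arrI[OF arrI.hyps(1-3)] arrI.prems(5)
        typing_env[OF arrI.hyps(1), of y K] arrI.hyps(3) by (auto intro: TT_UU.arrow)
  next
    case (Abs M')
    \<comment> \<open>The names to be avoided are chosen anew, because \<open>y\<close> may now be
      free in the opened body.\<close>
    have "splits_at (\<Gamma>((y, K) \<mapsto> U)) T x L N M'"
      using Abs arrI.prems(3,5) finite_fv
      by (intro arrI.IH[of "insert x (fst ` (fv M' \<union> fv N))"]) auto
    then obtain V where V: "M' \<Colon> \<langle>(\<Gamma>((y, K) \<mapsto> U, (x, L) \<mapsto> V)) |` fv M' \<turnstile> T\<rangle>"
      "N \<Colon> \<langle>(\<Gamma>((y, K) \<mapsto> U)) |` fv N \<turnstile> V\<rangle>" unfolding splits_at_def by blast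
    have "(y, K) \<in> fv P" using typing_dom[OF arrI.hyps(1)] by auto
    then have yK: "(y, K) \<in> fv M'" using Abs(3) fv_subst_subset[of x L N M'] fresh by blast
    \<comment> \<open>As \<open>y^K\<close> is free in \<open>M'\<close>, restriction keeps its
      declaration; as \<open>y\<close> differs from \<open>x\<close>, the two updates
      commute.\<close>
    have "(\<Gamma>((y, K) \<mapsto> U, (x, L) \<mapsto> V)) |` fv M' = ((\<Gamma>((x, L) \<mapsto> V)) |` fv M)((y, K) \<mapsto> U)"
      using yK fresh(1) Abs(1) by (auto simp: restrict_map_def fun_eq_iff fv_Abs)
    then have "M \<Colon> \<langle>(\<Gamma>((x, L) \<mapsto> V)) |` fv M \<turnstile> Arrow U T\<rangle>"
      unfolding Abs(1) using V(1) arrI.hyps(3) by (intro typing.arrI) (auto simp: fv_Abs)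
    moreover have "(\<Gamma>((y, K) \<mapsto> U)) |` fv N = \<Gamma> |` fv N"
      using fresh(3)[of K] by (auto simp: restrict_map_def fun_eq_iff)
    ultimately show ?thesis using V(2) unfolding splits_at_def by auto
  qed
next
  case (arrI' C P \<Gamma> y K T)
  have fresh: "y \<noteq> x" "\<And>J. (y, J) \<notin> fv M" "\<And>J. (y, J) \<notin> fv N"
    using arrI'.hyps(5) arrI'.prems(7) by force+
  show ?case
    using arrI'.prems(1-3) typing_terms[OF arrI'.hyps(1)] arrI'.prems(4,6) fresh
  proof (cases rule: subst_eq_AbsE)
    case Var
    then show ?thesis
      using splits_at_Var[of N \<Gamma> "Arrow (Omega K) T" L x] typing.arrI'[OF arrI'.hyps(1-3)]
        arrI'.prems(5) arrI'.hyps(3) by (auto intro: TT_UU.arrow TT_UU.omega)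
  next
    case (Abs M')
    have "splits_at \<Gamma> T x L N M'"
      using Abs arrI'.prems(3,5) finite_fv
      by (intro arrI'.IH[of "insert x (fst ` (fv M' \<union> fv N))"]) auto
    then obtain V where V: "M' \<Colon> \<langle>(\<Gamma>((x, L) \<mapsto> V)) |` fv M' \<turnstile> T\<rangle>" "N \<Colon> \<langle>\<Gamma> |` fv N \<turnstile> V\<rangle>"
      unfolding splits_at_def by blast
    have "(y, K) \<notin> fv P" using typing_dom[OF arrI'.hyps(1)] arrI'.hyps(2) by auto
    then have "(y, K) \<notin> fv M'" using Abs(3,5) fv_subst[of x L M' N] fresh by blast
    then have fv: "fv M = fv M'" and "(y, K) \<notin> dom ((\<Gamma>((x, L) \<mapsto> V)) |` fv M')"
      using Abs(1) by (auto simp: fv_Abs)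
    from typing.arrI'[OF V(1) this(2) arrI'.hyps(3)]
    have "M \<Colon> \<langle>(\<Gamma>((x, L) \<mapsto> V)) |` fv M \<turnstile> Arrow (Omega K) T\<rangle>"
      unfolding fv Abs(1)[symmetric] .
    then show ?thesis using V(2) unfolding splits_at_def by auto
  qed
next
  case (arrE C P\<^sub>1 \<Gamma>\<^sub>1 U T P\<^sub>2 \<Gamma>\<^sub>2)
  let ?\<Gamma> = "env_inter \<Gamma>\<^sub>1 \<Gamma>\<^sub>2"
  show ?case
  proof (cases M)
    case (Var z J)
    then show ?thesis
      using splits_at_Var[of N ?\<Gamma> T L x] typing.arrE[OF arrE.hyps(1-5)] arrE.hyps(5) arrE.prems
      by auto
  next
    case (App M\<^sub>1 M\<^sub>2)
    have P: "P\<^sub>1 = subst x L N M\<^sub>1" "P\<^sub>2 = subst x L N M\<^sub>2" using arrE.prems(1) App by auto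
    note M = terms_AppD[OF arrE.prems(2)[unfolded App]]
    have join: "M\<^sub>1 \<diamondop> N" "M\<^sub>2 \<diamondop> N"
      using arrE.prems(4) App by (auto intro: joinable_mono)
    have dom: "dom ?\<Gamma> = (fv M - {(x, L)}) \<union> fv N"
      using typing_dom[OF arrE.hyps(1)] typing_dom[OF arrE.hyps(2)] arrE.prems(1,6)
        fv_subst[of x L M N] by (metis dom_env_inter fv.simps(3))
    note le = env_inter_le1[OF arrE.hyps(1,2)] env_inter_le2[OF arrE.hyps(1,2)]
    have refl: "Arrow U T \<sqsubseteq> Arrow U T" "U \<sqsubseteq> U"
      using typing_UU[OF arrE.hyps(1)] arrE.hyps(4) by (auto intro: sub.refl)
    have split1: "splits_at ?\<Gamma> (Arrow U T) x L N M\<^sub>1" if "(x, L) \<in> fv M\<^sub>1"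
    proof (rule splits_at_weaken[OF _ _ _ refl(1)])
      show "splits_at \<Gamma>\<^sub>1 (Arrow U T) x L N M\<^sub>1"
        using that P M join arrE.prems(3,5) finite_fv
        by (intro arrE.IH(1)[of "insert x (fst ` (fv M\<^sub>1 \<union> fv N))"]) auto
    qed (use dom App le(1) in auto)
    have split2: "splits_at ?\<Gamma> U x L N M\<^sub>2" if "(x, L) \<in> fv M\<^sub>2"
    proof (rule splits_at_weaken[OF _ _ _ refl(2)])
      show "splits_at \<Gamma>\<^sub>2 U x L N M\<^sub>2"
        using that P M join arrE.prems(3,5) finite_fv
        by (intro arrE.IH(2)[of "insert x (fst ` (fv M\<^sub>2 \<union> fv N))"]) auto
    qed (use dom App le(2) in auto)
    \<comment> \<open>Substitution leaves a part without \<open>x^L\<close> unchanged, so its given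
      typing holds whichever type is put at \<open>x^L\<close>.\<close>
    have fresh1: "M\<^sub>1 \<Colon> \<langle>(?\<Gamma>((x, L) \<mapsto> V)) |` fv M\<^sub>1 \<turnstile> Arrow U T\<rangle>" if "(x, L) \<notin> fv M\<^sub>1" for V
      using arrE.hyps(1) that le(1) dom App P(1) subst_fresh[OF that, of N]
      by (intro typing_weaken_fresh_upd[of _ \<Gamma>\<^sub>1]) auto
    have fresh2: "M\<^sub>2 \<Colon> \<langle>(?\<Gamma>((x, L) \<mapsto> V)) |` fv M\<^sub>2 \<turnstile> U\<rangle>" if "(x, L) \<notin> fv M\<^sub>2" for V
      using arrE.hyps(2) that le(2) dom App P(2) subst_fresh[OF that, of N]
      by (intro typing_weaken_fresh_upd[of _ \<Gamma>\<^sub>2]) auto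
    \<comment> \<open>Both parts need a common type for \<open>x^L\<close>: the intersection if
      \<open>x^L\<close> occurs in both, otherwise the type from the part in which it does
      occur.\<close>
    have "\<exists>V. M\<^sub>1 \<Colon> \<langle>(?\<Gamma>((x, L) \<mapsto> V)) |` fv M\<^sub>1 \<turnstile> Arrow U T\<rangle> \<and>
        M\<^sub>2 \<Colon> \<langle>(?\<Gamma>((x, L) \<mapsto> V)) |` fv M\<^sub>2 \<turnstile> U\<rangle> \<and> N \<Colon> \<langle>?\<Gamma> |` fv N \<turnstile> V\<rangle>"
    proof (cases "(x, L) \<in> fv M\<^sub>1 \<and> (x, L) \<in> fv M\<^sub>2")
      case True
      then obtain V V' where "M\<^sub>1 \<Colon> \<langle>(?\<Gamma>((x, L) \<mapsto> V)) |` fv M\<^sub>1 \<turnstile> Arrow U T\<rangle>" "N \<Colon> \<langle>?\<Gamma> |` fv N \<turnstile> V\<rangle>"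
        "M\<^sub>2 \<Colon> \<langle>(?\<Gamma>((x, L) \<mapsto> V')) |` fv M\<^sub>2 \<turnstile> U\<rangle>" "N \<Colon> \<langle>?\<Gamma> |` fv N \<turnstile> V'\<rangle>"
        using split1 split2 unfolding splits_at_def by blast
      note V = typing_upd_Inter[OF this]
      have "fv M\<^sub>1 - {(x, L)} \<subseteq> dom ?\<Gamma>" "fv M\<^sub>2 - {(x, L)} \<subseteq> dom ?\<Gamma>" using dom App by auto
      then show ?thesis using V by blast
    next
      case False
      then show ?thesis
        using split1 split2 fresh1 fresh2 arrE.prems(6) App unfolding splits_at_def by auto
    qed
    then show ?thesis
      using typing_App_restrict[OF _ _ M(4) arrE.hyps(5)] unfolding splits_at_def App by blast
  qed (use arrE.prems in auto)
next
  case (interI C P \<Gamma> U\<^sub>1 U\<^sub>2)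
  have "splits_at \<Gamma> U\<^sub>1 x L N M" "splits_at \<Gamma> U\<^sub>2 x L N M"
    using interI.IH[OF interI.hyps(3)] interI.prems by auto
  then obtain V V' where V: "M \<Colon> \<langle>(\<Gamma>((x, L) \<mapsto> V)) |` fv M \<turnstile> U\<^sub>1\<rangle>" "N \<Colon> \<langle>\<Gamma> |` fv N \<turnstile> V\<rangle>"
    "M \<Colon> \<langle>(\<Gamma>((x, L) \<mapsto> V')) |` fv M \<turnstile> U\<^sub>2\<rangle>" "N \<Colon> \<langle>\<Gamma> |` fv N \<turnstile> V'\<rangle>"
    unfolding splits_at_def by blast
  have "fv M - {(x, L)} \<subseteq> dom \<Gamma>"
    using typing_dom[OF interI.hyps(1)] interI.prems fv_subst[of x L M N] by auto
  note V' = typing_upd_Inter[OF V this this]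
  show ?case
    unfolding splits_at_def using typing.interI[OF V'(1,2)] V'(3) by blast
next
  case (exp C P \<Gamma> U j)
  have "deg M = j # deg P" using exp.prems(1,5) deg_subst[of N L x M] by (metis deg_lift)
  then obtain M' where M': "M' \<in> terms" "M = lift j M'" using terms_deg_Cons exp.prems(2) by blast
  \<comment> \<open>The degree of \<open>M\<close> is a prefix of the index of each free variable.
    So \<open>L\<close>, the degree of \<open>N\<close>, is also headed by \<open>j\<close>, and
    \<open>N\<close> can be unlifted along with \<open>M\<close>.\<close>
  obtain L' where L': "L = j # L'"
    using terms_prefix_deg[OF exp.prems(2,6)] \<open>deg M = _\<close> by (auto simp: prefix_def)
  then obtain N' where N': "N' \<in> terms" "N = lift j N'"
    using terms_deg_Cons exp.prems(3,5) by blast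
  have xL: "(x, L') \<in> fv M'" using exp.prems(6) M' L' by (auto simp: fv_lift)
  have "lift j P = lift j (subst x L' N' M')"
    using exp.prems(1) M' N' L' by (simp add: subst_lift)
  then have "P = subst x L' N' M'" by (rule lift_inject)
  then have "splits_at \<Gamma> U x L' N' M'"
    using M' N' L' xL exp.prems(4,5) finite_fv
    by (intro exp.IH[of "insert x (fst ` (fv M' \<union> fv N'))"]) (auto simp: fv_lift joinable_lift)
  then obtain V where V: "M' \<Colon> \<langle>(\<Gamma>((x, L') \<mapsto> V)) |` fv M' \<turnstile> U\<rangle>" "N' \<Colon> \<langle>\<Gamma> |` fv N' \<turnstile> V\<rangle>"
    unfolding splits_at_def by blast
  have restr: "env_exp j (\<Delta> |` fv Q) = env_exp j \<Delta> |` fv (lift j Q)"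
    for \<Delta> :: "('v, 'a) env" and Q
    by (auto simp: env_exp_def restrict_map_def fun_eq_iff fv_lift image_iff split: list.splits)
  have "env_exp j (\<Gamma>((x, L') \<mapsto> V)) = (env_exp j \<Gamma>)((x, L) \<mapsto> Exp j V)"
    using L' by (auto simp: env_exp_def fun_eq_iff split: list.splits)
  then have "M \<Colon> \<langle>((env_exp j \<Gamma>)((x, L) \<mapsto> Exp j V)) |` fv M \<turnstile> Exp j U\<rangle>"
    using typing.exp[OF V(1), of j] unfolding restr M'(2) by simp
  moreover have "N \<Colon> \<langle>env_exp j \<Gamma> |` fv N \<turnstile> Exp j V\<rangle>"
    using typing.exp[OF V(2), of j] unfolding restr N'(2) .
  ultimately show ?case unfolding splits_at_def by blast
next
  case (sub C P \<Gamma> U \<Gamma>' U')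
  have split: "splits_at \<Gamma> U x L N M" using sub.IH[OF sub.hyps(4)] sub.prems by auto
  have dom: "dom \<Gamma>' = (fv M - {(x, L)}) \<union> fv N"
    using sub.hyps(2) typing_dom[OF sub.hyps(1)] sub.prems(1,6) fv_subst[of x L M N]
    by (auto simp: env_le_def)
  show ?case
    by (rule splits_at_weaken[OF split _ _ sub.hyps(3)])
      (use dom sub.hyps(2) in \<open>auto simp: env_le_def\<close>)
qed

section \<open>Environments extended by \<omega>, and expansion of one step\<close>

lemma env_up_id: "dom \<Gamma> = fv M \<Longrightarrow> env_up \<Gamma> M = \<Gamma>"
  by (auto simp: env_up_def map_add_def env_omega_def fun_eq_iff domIff split: option.splits)

text \<open>A variable of \<open>M\<close> missing from \<Gamma> but declared in \<Delta> receives
  \<omega> intersected with its type there; the degrees agree, so \<omega> is absorbed.\<close>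

lemma env_inter_up_left:
  assumes "dom \<Gamma> \<subseteq> fv M" "dom \<Delta> = fv N" "\<And>x L V. \<Delta> (x, L) = Some V \<Longrightarrow> tdeg V = L"
  shows "env_inter (env_up \<Gamma> M) \<Delta> = env_up (env_inter \<Gamma> \<Delta>) (App M N)"
proof
  fix v :: "'a ivar"
  obtain x L where v: "v = (x, L)" by (cases v)
  have "(x, L) \<in> fv N \<longleftrightarrow> \<Delta> (x, L) \<noteq> None" using assms(2) by auto
  moreover have "(x, L) \<in> fv M" if "\<Gamma> (x, L) \<noteq> None" using assms(1) that by auto
  ultimately show "env_inter (env_up \<Gamma> M) \<Delta> v = env_up (env_inter \<Gamma> \<Delta>) (App M N) v"
    using assms(3)[of x L] unfolding v
    by (auto simp: env_inter_def env_up_def map_add_def env_omega_def Inter_Omega_left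
        split: option.splits)
qed

lemma env_inter_up_right:
  assumes "dom \<Gamma> = fv M" "dom \<Delta> \<subseteq> fv N" "\<And>x L V. \<Gamma> (x, L) = Some V \<Longrightarrow> tdeg V = L"
  shows "env_inter \<Gamma> (env_up \<Delta> N) = env_up (env_inter \<Gamma> \<Delta>) (App M N)"
proof
  fix v :: "'a ivar"
  obtain x L where v: "v = (x, L)" by (cases v)
  have "(x, L) \<in> fv M \<longleftrightarrow> \<Gamma> (x, L) \<noteq> None" using assms(1) by auto
  moreover have "(x, L) \<in> fv N" if "\<Delta> (x, L) \<noteq> None" using assms(2) that by auto
  ultimately show "env_inter \<Gamma> (env_up \<Delta> N) v = env_up (env_inter \<Gamma> \<Delta>) (App M N) v"
    using assms(3)[of x L] unfolding v
    by (auto simp: env_inter_def env_up_def map_add_def env_omega_def Inter_Omega_right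
        split: option.splits)
qed

lemma typing_redex:
  fixes M :: "'v::infinite trm" and \<Gamma> :: "('v, 'a) env"
  assumes "subst x L N M \<Colon> \<langle>\<Gamma> \<turnstile> T\<rangle>" "T \<in> TT" "M \<in> terms" "N \<in> terms" "deg N = L" "M \<diamondop> N"
    "App (Abs x L M) N \<in> terms"
  shows "App (Abs x L M) N \<Colon> \<langle>env_up \<Gamma> (App (Abs x L M) N) \<turnstile> T\<rangle>"
proof (cases "(x, L) \<in> fv M")
  case True
  have "splits_at \<Gamma> T x L N M"
    using assms True finite_fv
    by (intro typing_subst_splits[OF assms(1), of "insert x (fst ` (fv M \<union> fv N))"]) auto
  then obtain V where V: "M \<Colon> \<langle>(\<Gamma>((x, L) \<mapsto> V)) |` fv M \<turnstile> T\<rangle>" "N \<Colon> \<langle>\<Gamma> |` fv N \<turnstile> V\<rangle>"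
    unfolding splits_at_def by blast
  have "(\<Gamma>((x, L) \<mapsto> V)) |` fv M = (\<Gamma> |` fv (Abs x L M))((x, L) \<mapsto> V)"
    using True by (auto simp: restrict_map_def fun_eq_iff fv_Abs)
  then have "Abs x L M \<Colon> \<langle>\<Gamma> |` fv (Abs x L M) \<turnstile> Arrow V T\<rangle>"
    using V(1) assms(2) by (intro typing.arrI) (auto simp: fv_Abs)
  from typing_App_restrict[OF this V(2) terms_AppD(4)[OF assms(7)] assms(2)]
  have "App (Abs x L M) N \<Colon> \<langle>\<Gamma> |` fv (App (Abs x L M) N) \<turnstile> T\<rangle>" .
  \<comment> \<open>With \<open>x^L\<close> occurring in \<open>M\<close>, contraction loses no free
    variable, so the extension of \<Gamma> adds nothing.\<close>
  moreover have "dom \<Gamma> = fv (App (Abs x L M) N)"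
    using typing_dom[OF assms(1)] fv_subst[OF True] by (simp add: fv_Abs)
  moreover from this have "\<Gamma> |` fv (App (Abs x L M) N) = \<Gamma>" by (rule restrict_dom)
  ultimately show ?thesis by (simp only: env_up_id)
next
  case False
  then have M: "M \<Colon> \<langle>\<Gamma> \<turnstile> T\<rangle>" using assms(1) by (simp add: subst_fresh)
  have dom: "dom \<Gamma> = fv (Abs x L M)" using typing_dom[OF M] False by (simp add: fv_Abs)
  have "Abs x L M \<Colon> \<langle>\<Gamma> \<turnstile> Arrow (Omega L) T\<rangle>"
    using M assms(2) dom by (intro typing.arrI') (auto simp: fv_Abs)
  moreover have "N \<Colon> \<langle>env_omega N \<turnstile> Omega L\<rangle>" using typing.omega[OF assms(4)] assms(5) by simp
  ultimately have "App (Abs x L M) N \<Colon> \<langle>env_inter \<Gamma> (env_omega N) \<turnstile> T\<rangle>"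
    using assms(2) terms_AppD(4)[OF assms(7)] dom
    by (auto intro!: typing.arrE TT_UU.omega)
  \<comment> \<open>The \<omega>-environment of \<open>N\<close> is read as the extension of the
    empty environment, which makes the intersection an extension of \<Gamma> to the whole
    redex.\<close>
  moreover have "env_inter \<Gamma> (env_up Map.empty N) = env_up (env_inter \<Gamma> Map.empty) (App (Abs x L M) N)"
    using dom typing_env[OF M] by (intro env_inter_up_right) auto
  moreover have "env_inter \<Gamma> Map.empty = \<Gamma>" "env_up Map.empty N = (env_omega N :: ('v, 'a) env)"
    by (auto simp: env_inter_def env_up_def fun_eq_iff split: option.splits)
  ultimately show ?thesis by simp
qed

text \<open>The axiom, arrow introductions and application conclude with a type in
  \<open>TT\<close>, so a redex contracted at the root is covered there by
  \<open>typing_redex\<close>; steps inside use the induction hypothesis. Avoiding the free names of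
  \<open>M\<close> makes the binder of the derivation usable in \<open>M\<close> too.\<close>

lemma typing_beta_expansion:
  fixes P :: "'v::infinite trm" and \<Gamma> :: "('v, 'a) env"
  shows "\<lbrakk>P \<Colon> \<langle>\<Gamma> \<turnstile> U\<rangle>; finite C; M \<rhd>\<^sub>\<beta> P; fst ` fv M \<subseteq> C\<rbrakk> \<Longrightarrow> M \<Colon> \<langle>env_up \<Gamma> M \<turnstile> U\<rangle>"
proof (induction arbitrary: M rule: typing_fresh_induct)
  case (ax C T x)
  \<comment> \<open>Only contraction at the root can produce a variable; the congruence rules yield
    an abstraction or an application.\<close>
  from ax.prems(1) show "M \<Colon> \<langle>env_up [(x, []) \<mapsto> T] M \<turnstile> T\<rangle>"
  proof (cases rule: beta.cases)
    case (redex M' N y L)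
    then show ?thesis
      using typing_redex[of y L N M' "[(x, []) \<mapsto> T]" T] typing.ax[OF ax(1), of x] ax(1) by simp
  qed (simp_all add: Abs_def)
next
  case (omega C P)
  have "env_up (env_omega P) M = (env_omega M :: ('v, 'a) env)"
    using beta_fv[OF omega.prems(1)]
    by (auto simp: env_up_def map_add_def env_omega_def fun_eq_iff split: option.splits)
  then show ?case
    using typing.omega[OF beta_terms[OF omega.prems(1)]] beta_deg[OF omega.prems(1)] by simp
next
  case (arrI C P \<Gamma> y K U T)
  have ty: "Abs y K P \<Colon> \<langle>\<Gamma> \<turnstile> Arrow U T\<rangle>" using arrI.hyps(1-3) by (rule typing.arrI)
  have fresh: "\<And>J. (y, J) \<notin> fv M" using arrI.hyps(5) arrI.prems(2) by force
  from arrI.prems(1) typing_terms[OF arrI.hyps(1)] fresh show ?case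
  proof (cases rule: beta_Abs_cases)
    case (redex x L M' N)
    moreover have "U \<in> UU" using typing_env[OF arrI.hyps(1), of y K] by simp
    ultimately show ?thesis
      using typing_redex[of x L N M' \<Gamma> "Arrow U T"] ty arrI.hyps(3) by (simp add: TT_UU.arrow)
  next
    case (abs M')
    have M': "M' \<Colon> \<langle>env_up (\<Gamma>((y, K) \<mapsto> U)) M' \<turnstile> T\<rangle>"
      using abs finite_fv by (intro arrI.IH[of "fst ` fv M'"]) auto
    have "env_up (\<Gamma>((y, K) \<mapsto> U)) M' = (env_up \<Gamma> M)((y, K) \<mapsto> U)"
      using abs by (auto simp: env_up_def map_add_def env_omega_def fun_eq_iff fv_Abs
          split: option.splits)
    moreover have "(y, K) \<notin> dom (env_up \<Gamma> M)"
      using arrI.hyps(2) fresh by (simp add: dom_env_up domIff)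
    ultimately show ?thesis
      using M' arrI.hyps(3) abs(1) typing.arrI[of M' "env_up \<Gamma> M" y K U T] by simp
  qed
next
  case (arrI' C P \<Gamma> y K T)
  have ty: "Abs y K P \<Colon> \<langle>\<Gamma> \<turnstile> Arrow (Omega K) T\<rangle>" using arrI'.hyps(1-3) by (rule typing.arrI')
  have fresh: "\<And>J. (y, J) \<notin> fv M" using arrI'.hyps(5) arrI'.prems(2) by force
  from arrI'.prems(1) typing_terms[OF arrI'.hyps(1)] fresh show ?case
  proof (cases rule: beta_Abs_cases)
    case (redex x L M' N)
    then show ?thesis
      using typing_redex[of x L N M' \<Gamma> "Arrow (Omega K) T"] ty arrI'.hyps(3)
      by (simp add: TT_UU.arrow TT_UU.omega)
  next
    case (abs M')
    have M': "M' \<Colon> \<langle>env_up \<Gamma> M' \<turnstile> T\<rangle>"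
      using arrI'.IH[of "fst ` fv M'"] abs finite_fv by auto
    have notin: "(y, K) \<notin> dom (env_up \<Gamma> M)"
      using arrI'.hyps(2) fresh by (simp add: dom_env_up domIff)
    show ?thesis
    \<comment> \<open>The step may have erased \<open>y^K\<close>. If it is still free before the
      step, its declaration is \<omega> at index \<open>K\<close>, and ordinary introduction yields
      the same arrow type.\<close>
    proof (cases "(y, K) \<in> fv M'")
      case True
      then have "env_up \<Gamma> M' = (env_up \<Gamma> M)((y, K) \<mapsto> Omega K)"
        using abs arrI'.hyps(2)
        by (auto simp: env_up_def map_add_def env_omega_def fun_eq_iff fv_Abs split: option.splits)
      then show ?thesis
        using M' arrI'.hyps(3) abs(1) notin typing.arrI[of M' "env_up \<Gamma> M" y K "Omega K" T] by simp
    next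
      case False
      then have "env_up \<Gamma> M' = env_up \<Gamma> M"
        using abs by (simp add: env_up_def env_omega_def fv_Abs)
      then show ?thesis
        using M' arrI'.hyps(3) abs(1) notin typing.arrI'[of M' "env_up \<Gamma> M" T y K] by simp
    qed
  qed
next
  case (arrE C P\<^sub>1 \<Gamma>\<^sub>1 U T P\<^sub>2 \<Gamma>\<^sub>2)
  note dom = typing_dom[OF arrE.hyps(1)] typing_dom[OF arrE.hyps(2)]
  from arrE.prems(1) show ?case
  proof (cases rule: beta.cases)
    case (redex M' N x L)
    then show ?thesis
      using typing_redex[of x L N M' "env_inter \<Gamma>\<^sub>1 \<Gamma>\<^sub>2" T] typing.arrE[OF arrE.hyps(1-5)] arrE.hyps(5)
      by simp
  next
    case (appL M\<^sub>1)
    then have M: "M = App M\<^sub>1 P\<^sub>2" "M\<^sub>1 \<rhd>\<^sub>\<beta> P\<^sub>1" by auto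
    have sub: "dom \<Gamma>\<^sub>1 \<subseteq> fv M\<^sub>1" using dom beta_fv[OF M(2)] by simp
    have "M\<^sub>1 \<Colon> \<langle>env_up \<Gamma>\<^sub>1 M\<^sub>1 \<turnstile> Arrow U T\<rangle>"
      using arrE.IH(1)[of "fst ` fv M\<^sub>1"] M finite_fv by auto
    \<comment> \<open>The extended environment has domain \<open>fv M\<^sub>1\<close>, so its
      joinability with \<open>\<Gamma>\<^sub>2\<close> is the condition under which the expanded
      application is a term.\<close>
    moreover have "M\<^sub>1 \<diamondop> P\<^sub>2" using appL M terms_AppD(4) by blast
    ultimately have "M \<Colon> \<langle>env_inter (env_up \<Gamma>\<^sub>1 M\<^sub>1) \<Gamma>\<^sub>2 \<turnstile> T\<rangle>"
      using arrE.hyps dom sub by (auto simp: M dom_env_up Un_absorb1 intro!: typing.arrE)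
    moreover have "env_inter (env_up \<Gamma>\<^sub>1 M\<^sub>1) \<Gamma>\<^sub>2 = env_up (env_inter \<Gamma>\<^sub>1 \<Gamma>\<^sub>2) M"
      unfolding M using sub dom typing_env[OF arrE.hyps(2)] by (intro env_inter_up_left) auto
    ultimately show ?thesis by simp
  next
    case (appR M\<^sub>2)
    then have M: "M = App P\<^sub>1 M\<^sub>2" "M\<^sub>2 \<rhd>\<^sub>\<beta> P\<^sub>2" by auto
    have sub: "dom \<Gamma>\<^sub>2 \<subseteq> fv M\<^sub>2" using dom beta_fv[OF M(2)] by simp
    have "M\<^sub>2 \<Colon> \<langle>env_up \<Gamma>\<^sub>2 M\<^sub>2 \<turnstile> U\<rangle>"
      using arrE.IH(2)[of "fst ` fv M\<^sub>2"] M finite_fv by auto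
    moreover have "P\<^sub>1 \<diamondop> M\<^sub>2" using appR M terms_AppD(4) by blast
    ultimately have "M \<Colon> \<langle>env_inter \<Gamma>\<^sub>1 (env_up \<Gamma>\<^sub>2 M\<^sub>2) \<turnstile> T\<rangle>"
      using arrE.hyps dom sub by (auto simp: M dom_env_up Un_absorb1 intro!: typing.arrE)
    moreover have "env_inter \<Gamma>\<^sub>1 (env_up \<Gamma>\<^sub>2 M\<^sub>2) = env_up (env_inter \<Gamma>\<^sub>1 \<Gamma>\<^sub>2) M"
      unfolding M using sub dom typing_env[OF arrE.hyps(1)] by (intro env_inter_up_right) auto
    ultimately show ?thesis by simp
  qed (simp_all add: Abs_def)
next
  case (interI C P \<Gamma> U\<^sub>1 U\<^sub>2)
  then show ?case by (blast intro: typing.interI)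
next
  case (exp C P \<Gamma> U j)
  have "deg M = j # deg P" using beta_deg[OF exp.prems(1)] by simp
  then obtain M' P' where M': "M = lift j M'" "lift j P = lift j P'" "M' \<rhd>\<^sub>\<beta> P'"
    using beta_deg_Cons[OF exp.prems(1)] by blast
  then have "M' \<rhd>\<^sub>\<beta> P" using lift_inject by blast
  then have "M' \<Colon> \<langle>env_up \<Gamma> M' \<turnstile> U\<rangle>" using exp.IH[of "fst ` fv M'"] finite_fv by auto
  \<comment> \<open>Extension commutes with expansion because an expansion variable applied to
    \<omega> gives \<omega> at the lifted index.\<close>
  moreover have "env_exp j (env_up \<Gamma> M') = env_up (env_exp j \<Gamma>) M"
    unfolding M'
    by (auto simp: env_exp_def env_up_def map_add_def env_omega_def fun_eq_iff fv_lift image_iff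
        Exp_Omega split: list.splits option.splits)
  ultimately show ?case using typing.exp[of M' "env_up \<Gamma> M'" U j] M' by simp
next
  case (sub C P \<Gamma> U \<Gamma>' U')
  have M: "M \<Colon> \<langle>env_up \<Gamma> M \<turnstile> U\<rangle>" using sub.IH[OF sub.hyps(4)] sub.prems by blast
  have dom: "dom \<Gamma> = dom \<Gamma>'" using sub.hyps(2) by (simp add: env_le_def)
  \<comment> \<open>The two domains agree, so both extensions add \<omega> at the same variables; at
    all others the given subtypings apply.\<close>
  have "env_le (env_up \<Gamma>' M) (env_up \<Gamma> M)"
    unfolding env_le_def
  proof (intro conjI allI impI)
    show "dom (env_up \<Gamma>' M) = dom (env_up \<Gamma> M)" by (simp add: dom_env_up dom)
    show "finite (dom (env_up \<Gamma>' M))"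
      using sub.hyps(2) finite_fv[of M] unfolding dom_env_up env_le_def by blast
    fix v A B assume AB: "env_up \<Gamma>' M v = Some A" "env_up \<Gamma> M v = Some B"
    show "A \<sqsubseteq> B"
    proof (cases "v \<in> dom \<Gamma>")
      case True
      then have "\<Gamma>' v = Some A" "\<Gamma> v = Some B"
        using AB dom by (auto simp: env_up_def map_add_dom_app_simps)
      then show ?thesis using sub.hyps(2) unfolding env_le_def by blast
    next
      case False
      then have "A = B" using AB dom by (auto simp: env_up_def map_add_dom_app_simps)
      then show ?thesis using typing_env[OF M, of "fst v" "snd v"] AB by (auto intro: sub.refl)
    qed
  qed
  then show ?case
    using typing.sub[OF M, of "env_up \<Gamma>' M" U'] sub.hyps(3) by (simp add: sub_typing_iff)
qed

theorem theorem5: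
  fixes M N :: "'v::{countable,infinite} trm"
    and \<Gamma> :: "('v, 'a) env"
    and U :: "'a ty"
  assumes "N \<Colon> \<langle>\<Gamma> \<turnstile> U\<rangle>"
    and "M \<rhd>\<^sub>\<beta>\<^sup>* N"
  shows "M \<Colon> \<langle>env_up \<Gamma> M \<turnstile> U\<rangle>"
  using assms(2)
\<comment> \<open>Steps are added at the front, starting from the typed term \<open>N\<close>, whose
  environment already declares all its free variables.\<close>
proof (induction rule: converse_rtranclp_induct)
  case base
  then show ?case using assms(1) typing_dom[OF assms(1)] by (simp add: env_up_id)
next
  case (step M M')
  have "M \<Colon> \<langle>env_up (env_up \<Gamma> M') M \<turnstile> U\<rangle>"
    using typing_beta_expansion[OF step.IH, of "fst ` fv M" M] step.hyps(1) finite_fv by auto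
  \<comment> \<open>The free variables of \<open>M'\<close> are among those of \<open>M\<close>, so
    the two successive extensions amount to one.\<close>
  moreover have "env_up (env_up \<Gamma> M') M = env_up \<Gamma> M"
    using beta_fv[OF step.hyps(1)]
    by (auto simp: env_up_def map_add_def env_omega_def fun_eq_iff split: option.splits)
  ultimately show ?case by simp
qed

end
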